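(* Let $K\ge 1$ and consider the canonical data shuffling problem with $K$ worker nodes, $N=K$ files and cache size $S$ at each worker node. For a file transition graph $\mathcal G$ comprising $\gamma$ cycles, the optimal delivery load is $$R^\star(N=K,K,S)=R^\star(\mathcal G)=\frac{\binom{K-1}{S}-\binom{\gamma-1}{S}}{\binom{K-1}{S-1}},\qquad S\in[N].$$ For non-integer $S$ with $1\le S\le N$, $R^\star(\mathcal G)$ equals the value at $S$ of the lower convex envelope of the $N$ corner points $\Big(s,\big(\binom{K-1}{s}-\binom{\gamma-1}{s}\big)/\binom{K-1}{s-1}\Big)$, $s\in[N]$. Furthermore, for integer $S\in[N]$, when $\gamma-1<S$ the load above equals $\binom{K-1}{S}/\binom{K-1}{S-1}$, which is its maximum over $\gamma$, and the optimal worst-case delivery load is $$R^\star_{\text{worst-case}}=\frac{\binom{K-1}{S}}{\binom{K-1}{S-1}}.$$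
   Context: Notation: $[K]=\{1,\dots,K\}$; $\binom{n}{k}=0$ when $n<k$. Canonical data shuffling problem ($N=K$). There are $K$ files $F^1,\dots,F^K$, each a string of $B$ bits ($B$ a positive integer; the files are independent and uniformly distributed); the size of a file is normalized to $1$, i.e. all sizes are measured in units of $B$ bits. There are $K$ worker nodes $W_1,\dots,W_K$ and a master node that knows all files. At iteration $t$, worker $W_i$ processes file $F^i$ and stores it completely. Each worker has a cache of size $S$ files, where $1\le S\le K$ is real. An uncoded placement (with cache size $S$ and file length $B$) specifies, for every ordered pair $i\ne j$ in $[K]$, a set $\widetilde F^i_j$ of bits (bit positions) of $F^i$ stored in the excess storage of $W_j$, such that $\sum_{i\neq j}|\widetilde F^i_j|\le (S-1)B$ for every $j$. The cache content of $W_j$ is $\mathcal Z_j=F^j\cup\bigcup_{i\ne j}\widetilde F^i_j$. The placement is chosen without knowledge of the next assignment (it is the same for all $d$). The next assignment is a permutation $d$ of $[K]$: at iteration $t+1$ worker $W_i$ must process $F^{d(i)}$. A delivery for $d$ of load $L/B$ is a function $\mathcal X$ of all files with values in $\{0,1\}^L$ (broadcast by the master to all workers without error) such that for every $i\in[K]$ the file $F^{d(i)}$ is a function of $(\mathcal X,\mathcal Z_i)$. For a placement $P$, let $R(P;d)$ be the minimum load of a delivery for $d$. The file transition graph of $d$ is the directed graph on the workers with one edge per file, the edge of file $F^j$ going from the worker processing $F^j$ at iteration $t$ (namely $W_j$) to the worker assigned $F^j$ at iteration $t+1$ (namely $W_{d^{-1}(j)}$). It is a disjoint union of directed cycles (loops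 count as cycles of length 1). $\mathcal D_{\mathcal G}$ is the set of all permutations $d$ of $[K]$ whose file transition graph is isomorphic to $\mathcal G$. Optimal loads: $R^\star(\mathcal G)=\inf_{B,P}\frac1{|\mathcal D_{\mathcal G}|}\sum_{d\in\mathcal D_{\mathcal G}}R(P;d)$ and $R^\star_{\text{worst-case}}=\inf_{B,P}\max_{d}R(P;d)$, the infima being over all file lengths $B$ and all uncoded placements $P$ with cache size $S$, and the maximum over all permutations $d$ of $[K]$. *)

theory Defs
  imports "HOL-Analysis.Analysis" "Graph_Theory.Digraph_Isomorphism"
begin

definition file_tuples :: "nat \<Rightarrow> nat \<Rightarrow> (nat \<Rightarrow> bool list) set" where
  "file_tuples K B = {1..K} \<rightarrow>\<^sub>E {w. length w = B}"

text \<open>\<open>P i j\<close> is the set of positions of the bits of file \<open>i\<close> that worker \<open>j\<close> keeps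
  in its excess storage; it is only meaningful for distinct \<open>i\<close> and \<open>j\<close>.\<close>

type_synonym placement = "nat \<Rightarrow> nat \<Rightarrow> nat set"

definition uncoded_placement :: "nat \<Rightarrow> real \<Rightarrow> nat \<Rightarrow> placement \<Rightarrow> bool" where
  "uncoded_placement K S B P \<longleftrightarrow>
     (\<forall>j\<in>{1..K}. \<forall>i\<in>{1..K} - {j}. P i j \<subseteq> {..<B}) \<and>
     (\<forall>j\<in>{1..K}. real (\<Sum>i\<in>{1..K} - {j}. card (P i j)) \<le> (S - 1) * real B)"

text \<open>What worker \<open>j\<close> knows when the files are \<open>F\<close>: its own file, and the values of the
  bits in its excess storage (\<open>None\<close> marks the positions it does not store).\<close>

definition cache :: "nat \<Rightarrow> placement \<Rightarrow> nat \<Rightarrow> (nat \<Rightarrow> bool list)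
    \<Rightarrow> bool list \<times> (nat \<Rightarrow> nat \<Rightarrow> bool option)" where
  "cache K P j F =
     (F j, \<lambda>i b. if i \<in> {1..K} - {j} \<and> b \<in> P i j then Some (F i ! b) else None)"

text \<open>\<open>X\<close> is the broadcast message as a function of the files and \<open>L\<close> its length in bits.
  Decoding must be correct for every tuple of files; for independent uniform files this is
  the same as zero error probability.\<close>

definition is_delivery ::
  "nat \<Rightarrow> nat \<Rightarrow> placement \<Rightarrow> (nat \<Rightarrow> nat) \<Rightarrow> nat \<Rightarrow> ((nat \<Rightarrow> bool list) \<Rightarrow> bool list) \<Rightarrow> bool" where
  "is_delivery K B P d L X \<longleftrightarrow>
     (\<forall>F\<in>file_tuples K B. length (X F) = L) \<and>
     (\<forall>i\<in>{1..K}. \<exists>decode. \<forall>F\<in>file_tuples K B. F (d i) = decode (X F) (cache K P i F))"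

definition min_load :: "nat \<Rightarrow> nat \<Rightarrow> placement \<Rightarrow> (nat \<Rightarrow> nat) \<Rightarrow> real" where
  "min_load K B P d = real (LEAST L. \<exists>X. is_delivery K B P d L X) / real B"

text \<open>Vertices are workers and arcs are files. File \<open>j\<close> is moved from worker \<open>j\<close> to the
  worker \<open>i\<close> with \<open>d i = j\<close>.\<close>

definition transition_graph :: "nat \<Rightarrow> (nat \<Rightarrow> nat) \<Rightarrow> (nat, nat) pre_digraph" where
  "transition_graph K d =
     \<lparr>verts = {1..K}, arcs = {1..K}, tail = (\<lambda>j. j), head = (\<lambda>j. inv d j)\<rparr>"

definition is_file_transition_graph :: "nat \<Rightarrow> (nat, nat) pre_digraph \<Rightarrow> bool" where
  "is_file_transition_graph K G \<longleftrightarrow> (\<exists>d. d permutes {1..K} \<and> G = transition_graph K d)"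

text \<open>A cycle of the library is a closed walk with a starting point (loops are included);
  passing to arc sets identifies the rotations of the same cycle.\<close>

definition num_cycles :: "('v, 'a) pre_digraph \<Rightarrow> nat" where
  "num_cycles G = card {set p |p. pre_digraph.cycle G p}"

definition assignments_of :: "nat \<Rightarrow> (nat, nat) pre_digraph \<Rightarrow> (nat \<Rightarrow> nat) set" where
  "assignments_of K G = {d. d permutes {1..K} \<and> digraph_iso (transition_graph K d) G}"

definition opt_load :: "nat \<Rightarrow> real \<Rightarrow> (nat, nat) pre_digraph \<Rightarrow> real" where
  "opt_load K S G =
     Inf {(\<Sum>d\<in>assignments_of K G. min_load K B P d) / real (card (assignments_of K G)) |B P.
            B > 0 \<and> uncoded_placement K S B P}"

definition opt_worst_case_load :: "nat \<Rightarrow> real \<Rightarrow> real" where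
  "opt_worst_case_load K S =
     Inf {Max ((\<lambda>d. min_load K B P d) ` {d. d permutes {1..K}}) |B P.
            B > 0 \<and> uncoded_placement K S B P}"

text \<open>Used for \<open>K \<ge> 1\<close>, \<open>\<gamma> \<ge> 1\<close> and \<open>s \<ge> 1\<close>, so the subtractions on \<open>nat\<close> do not truncate.\<close>

definition corner_load :: "nat \<Rightarrow> nat \<Rightarrow> nat \<Rightarrow> real" where
  "corner_load K \<gamma> s =
     (real ((K - 1) choose s) - real ((\<gamma> - 1) choose s)) / real ((K - 1) choose (s - 1))"

definition lower_convex_envelope :: "(real \<times> real) set \<Rightarrow> real \<Rightarrow> real" where
  "lower_convex_envelope A x = Inf {y. (x, y) \<in> convex hull A}"

end

theory Submission
  imports Defs "HOL-Combinatorics.Orbits" "HOL-Library.Z2"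
begin

text \<open>Achievability. Every file is cut into parts indexed by the \<open>s\<close>-sets \<open>W\<close> of workers that contain
  its owner; a worker knows the part \<open>W\<close> iff it belongs to \<open>W\<close>. For an \<open>(s + 1)\<close>-set \<open>U\<close>, let \<open>Y U\<close> be
  the sum over \<open>i \<in> U\<close> of the part \<open>U - {i}\<close> of the file requested by \<open>i\<close>, and let \<open>X T\<close> be the sum of
  \<open>Y (T \<union> {k})\<close> over \<open>k \<notin> T\<close>. Every worker decodes each missing part from a single \<open>X T\<close>. Over the
  field with two elements, \<open>X\<close> is a simplicial boundary, so the \<open>X T\<close> with \<open>r \<in> T\<close> are redundant, and
  the sum of \<open>X T\<close> over all transversals \<open>T\<close> of \<open>s\<close> cycles vanishes, which makes another
  \<open>(\<gamma> - 1) choose s\<close> of them redundant. Non-integral \<open>S\<close> is reached by memory sharing.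

  Converse. Remove one worker from each cycle and visit the others along the remaining paths. A
  receiver that has the message and the caches met so far decodes one new file per step. The load is at
  least the number of new bits, and averaging this bound over the conjugates of \<open>d\<close>, which are
  exactly the assignments with the same graph, gives \<open>corner_load\<close> at one plus the number of
  excess copies of a bit, averaged over all bits. Convexity in \<open>s\<close> concludes.\<close>

section \<open>Coded messages over the field with two elements\<close>

text \<open>\<open>g x W\<close> is the part of file \<open>x\<close> that is known to the workers in \<open>W\<close>; it is only used for
  \<open>x \<in> W\<close>.\<close>

definition multicast :: "('a \<Rightarrow> 'a) \<Rightarrow> ('a \<Rightarrow> 'a set \<Rightarrow> bit) \<Rightarrow> 'a set \<Rightarrow> bit" where
  "multicast d g U = (\<Sum>i\<in>U. if d i \<in> U - {i} then g (d i) (U - {i}) else 0)"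

definition coded_msg :: "'a set \<Rightarrow> ('a \<Rightarrow> 'a) \<Rightarrow> ('a \<Rightarrow> 'a set \<Rightarrow> bit) \<Rightarrow> 'a set \<Rightarrow> bit" where
  "coded_msg V d g T = (\<Sum>k\<in>V - T. multicast d g (insert k T))"

lemma bit_add_self [simp]: "x + x = (0 :: bit)"
  by (cases x) auto

text \<open>By linearity, decoding reduces to showing that requested parts vanish when the messages
  and the known parts do.\<close>

lemma coded_msg_add:
  "coded_msg V d (\<lambda>x W. g x W + g' x W) T = coded_msg V d g T + coded_msg V d g' T"
  unfolding coded_msg_def multicast_def sum.distrib[symmetric]
  by (intro sum.cong refl) auto

text \<open>Every unordered pair is counted twice, and twice anything is zero here.\<close>

lemma sum_symmetric_off_diagonal_bit:
  fixes h :: "'a \<Rightarrow> 'a \<Rightarrow> bit"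
  assumes "finite A" and sym: "\<And>i k. h i k = h k i"
  shows "(\<Sum>i\<in>A. \<Sum>k\<in>A - {i}. h i k) = 0"
  using assms(1)
proof (induction A)
  case (insert a A)
  have "(\<Sum>i\<in>A. \<Sum>k\<in>insert a A - {i}. h i k) = (\<Sum>i\<in>A. h a i + (\<Sum>k\<in>A - {i}. h i k))"
  proof (rule sum.cong[OF refl])
    fix i assume "i \<in> A"
    then have "insert a A - {i} = insert a (A - {i})" using insert by auto
    then show "(\<Sum>k\<in>insert a A - {i}. h i k) = h a i + (\<Sum>k\<in>A - {i}. h i k)"
      using insert sym[of i a] by simp
  qed
  moreover have "insert a A - {a} = A" using insert by auto
  ultimately have "(\<Sum>i\<in>insert a A. \<Sum>k\<in>insert a A - {i}. h i k)
      = (\<Sum>i\<in>A. h a i) + ((\<Sum>i\<in>A. h a i) + (\<Sum>i\<in>A. \<Sum>k\<in>A - {i}. h i k))"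
    unfolding sum.insert[OF insert.hyps] by (simp only: sum.distrib)
  then show ?case
    unfolding add.assoc[symmetric] bit_add_self insert.IH by simp
qed simp

text \<open>The messages form the boundary of the chain \<open>multicast d g\<close>, and a boundary has
  boundary zero.\<close>

lemma sum_coded_msg_insert:
  assumes "finite V"
  shows "(\<Sum>i\<in>V - C. coded_msg V d g (insert i C)) = 0"
proof -
  have "(\<Sum>i\<in>V - C. coded_msg V d g (insert i C))
      = (\<Sum>i\<in>V - C. \<Sum>k\<in>V - C - {i}. multicast d g (insert k (insert i C)))"
    unfolding coded_msg_def by (intro sum.cong refl) auto
  also have "\<dots> = 0"
    by (rule sum_symmetric_off_diagonal_bit) (use assms in \<open>auto simp: insert_commute\<close>)
  finally show ?thesis .
qed

section \<open>Relations among the messages of transversals\<close>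

lemma orbit_eq_iff:
  assumes "permutation d"
  shows "orbit d x = orbit d y \<longleftrightarrow> x \<in> orbit d y"
  using orbit_cyclic_eq3[OF cyclic_on_orbit'[OF assms]] permutation_self_in_orbit[OF assms] by auto

lemma orbit_inv_mem:
  assumes "permutation d"
  shows "inv d x \<in> orbit d x"
  using orbit.base[of "inv d" x] orbit_inv_eq[OF assms] by metis

lemma multicast_insert:
  assumes "k \<notin> T" "finite T"
  shows "multicast d g (insert k T) =
    (if d k \<in> T then g (d k) T else 0)
    + (\<Sum>i\<in>T. if d i \<in> insert k T - {i} then g (d i) (insert k T - {i}) else 0)"
  unfolding multicast_def using assms by simp

text \<open>In \<open>multicast d g (insert k T)\<close> the request of the added worker
  \<open>k\<close> concerns the part \<open>T\<close> itself; it is reindexed by the file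
  \<open>y = d k\<close>. The requests of \<open>i \<in> T\<close> concern the sets in which
  \<open>i\<close> is exchanged for \<open>k\<close>.\<close>

lemma coded_msg_alt:
  assumes V: "finite V" and d: "d permutes V" and T: "T \<subseteq> V"
  shows "coded_msg V d g T =
      (\<Sum>y\<in>T. if inv d y \<notin> T then g y T else 0)
    + (\<Sum>i\<in>T. \<Sum>k\<in>V - T. if d i \<in> insert k T - {i} then g (d i) (insert k T - {i}) else 0)"
proof -
  have fT: "finite T" using V T finite_subset by auto
  have "coded_msg V d g T = (\<Sum>k\<in>V - T. if d k \<in> T then g (d k) T else 0)
    + (\<Sum>k\<in>V - T. \<Sum>i\<in>T. if d i \<in> insert k T - {i} then g (d i) (insert k T - {i}) else 0)"
    unfolding coded_msg_def sum.distrib[symmetric]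
    by (intro sum.cong refl multicast_insert) (use fT in auto)
  moreover have "(\<Sum>k\<in>V - T. if d k \<in> T then g (d k) T else 0)
      = (\<Sum>k\<in>{k\<in>V - T. d k \<in> T}. g (d k) T)"
    by (rule sum.inter_filter[symmetric]) (use V in auto)
  moreover have "\<dots> = (\<Sum>y\<in>{y\<in>T. inv d y \<notin> T}. g y T)"
    by (rule sum.reindex_bij_witness[of _ "inv d" d])
      (use T d permutes_in_image[OF permutes_inv[OF d]] in
        \<open>auto simp: permutes_inverses[OF d]\<close>)
  moreover have "\<dots> = (\<Sum>y\<in>T. if inv d y \<notin> T then g y T else 0)"
    by (rule sum.inter_filter) (rule fT)
  moreover have "(\<Sum>k\<in>V - T. \<Sum>i\<in>T. if d i \<in> insert k T - {i} then g (d i) (insert k T - {i}) else 0)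
      = (\<Sum>i\<in>T. \<Sum>k\<in>V - T. if d i \<in> insert k T - {i} then g (d i) (insert k T - {i}) else 0)"
    by (rule sum.swap)
  ultimately show ?thesis by (simp only:)
qed

text \<open>Each \<open>h\<close> chooses one worker from each cycle that meets \<open>T\<close>.
  Moving the chosen worker of one cycle a step along \<open>d\<close> permutes these choices and
  matches the two kinds of terms in \<open>coded_msg_alt\<close>, which therefore cancel in
  pairs.\<close>

lemma sum_coded_msg_transversal:
  assumes V: "finite V" and d: "d permutes V" and T: "T \<subseteq> V" and inj: "inj_on (orbit d) T"
  shows "(\<Sum>h\<in>PiE T (orbit d). coded_msg V d g (h ` T)) = 0"
proof -
  have perm: "permutation d" using V d permutation_permutes by blast
  have fT: "finite T" using V T finite_subset by auto
  have orb: "orbit d (h x) = orbit d x" if "h \<in> PiE T (orbit d)" "x \<in> T" for h x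
    using that orbit_eq_iff[OF perm] by auto
  \<comment> \<open>A step of \<open>d\<close> or \<open>inv d\<close> stays in its cycle, and
    distinct points of \<open>T\<close> lie in distinct cycles, so these coincidences cannot involve
    two coordinates.\<close>
  have sep: "h x = h y \<Longrightarrow> x = y" "d (h x) = h y \<Longrightarrow> x = y" "inv d (h x) = h y \<Longrightarrow> x = y"
    if "h \<in> PiE T (orbit d)" "x \<in> T" "y \<in> T" for h x y
  proof -
    have "x = y" if "h y \<in> orbit d (h x)"
    proof -
      have "orbit d (h y) = orbit d (h x)" using that orbit_eq_iff[OF perm] by auto
      then show ?thesis using orb \<open>h \<in> _\<close> \<open>x \<in> T\<close> \<open>y \<in> T\<close> inj by (metis inj_onD)
    qed
    then show "h x = h y \<Longrightarrow> x = y" "d (h x) = h y \<Longrightarrow> x = y" "inv d (h x) = h y \<Longrightarrow> x = y"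
      using orbit_inv_mem[OF perm] orbit.base[of d] permutation_self_in_orbit[OF perm] by metis+
  qed
  \<comment> \<open>\<open>A x h\<close> belongs to the request of the chosen worker
    \<open>h x\<close>: only the summand with \<open>k = d (h x)\<close> yields a set containing the
    owner of the requested file. \<open>C x h\<close> belongs to the request of
    \<open>inv d (h x)\<close>. Fixed points of \<open>d\<close> request nothing new.\<close>
  define A where "A x h = (if d (h x) \<noteq> h x then g (d (h x)) (h(x := d (h x)) ` T) else 0)" for x h
  define C where "C x h = (if inv d (h x) \<noteq> h x then g (h x) (h ` T) else 0)" for x h
  have split: "coded_msg V d g (h ` T) = (\<Sum>x\<in>T. C x h) + (\<Sum>x\<in>T. A x h)"
    if h: "h \<in> PiE T (orbit d)" for h
  proof -
    have sub: "h ` T \<subseteq> V" using h T permutes_orbit_subset[OF d] by fastforce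
    have injh: "inj_on h T" by (rule inj_onI) (use sep(1)[OF h] in auto)
    have "(\<Sum>y\<in>h ` T. if inv d y \<notin> h ` T then g y (h ` T) else 0) = (\<Sum>x\<in>T. C x h)"
      unfolding sum.reindex[OF injh] o_def C_def
    proof (intro sum.cong refl if_cong)
      fix x assume "x \<in> T"
      then show "(inv d (h x) \<notin> h ` T) = (inv d (h x) \<noteq> h x)" using sep(3)[OF h] by force
    qed
    moreover have "(\<Sum>i\<in>h ` T. \<Sum>k\<in>V - h ` T.
        if d i \<in> insert k (h ` T) - {i} then g (d i) (insert k (h ` T) - {i}) else 0)
      = (\<Sum>x\<in>T. A x h)"
      unfolding sum.reindex[OF injh] o_def
    proof (rule sum.cong[OF refl])
      fix x assume x: "x \<in> T"
      let ?i = "h x"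
      show "(\<Sum>k\<in>V - h ` T.
        if d ?i \<in> insert k (h ` T) - {?i} then g (d ?i) (insert k (h ` T) - {?i}) else 0) = A x h"
      proof (cases "d ?i = ?i")
        case True then show ?thesis by (simp add: A_def)
      next
        case False
        have nin: "d ?i \<notin> h ` T" using sep(2)[OF h x] False by force
        have dV: "d ?i \<in> V" using sub x permutes_in_image[OF d] by blast
        have im: "insert (d ?i) (h ` T) - {?i} = h(x := d ?i) ` T"
          using x sep(1)[OF h x] False nin by (force simp: image_iff)
        have "(\<Sum>k\<in>V - h ` T.
            if d ?i \<in> insert k (h ` T) - {?i} then g (d ?i) (insert k (h ` T) - {?i}) else 0)
          = (\<Sum>k\<in>V - h ` T. if k = d ?i then g (d ?i) (insert (d ?i) (h ` T) - {?i}) else 0)"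
          by (intro sum.cong refl) (use nin False in auto)
        also have "\<dots> = A x h" using V nin dV False unfolding A_def im by simp
        finally show ?thesis .
      qed
    qed
    ultimately show ?thesis using coded_msg_alt[OF V d sub] by simp
  qed
  have "(\<Sum>h\<in>PiE T (orbit d). A x h) = (\<Sum>h\<in>PiE T (orbit d). C x h)" if x: "x \<in> T" for x
  proof (rule sum.reindex_bij_witness[of _ "\<lambda>h. h(x := inv d (h x))" "\<lambda>h. h(x := d (h x))"])
    fix h assume h: "h \<in> PiE T (orbit d)"
    have hx: "h x \<in> orbit d x" using h x by auto
    show "h(x := d (h x)) \<in> PiE T (orbit d)"
      using h x hx orbit.step[of "h x" d x] by (auto simp: PiE_iff extensional_def)
    show "h(x := inv d (h x)) \<in> PiE T (orbit d)"
      using h x hx orbit_trans[OF orbit_inv_mem[OF perm] hx] by (auto simp: PiE_iff extensional_def)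
    show "C x (h(x := d (h x))) = A x h"
      unfolding C_def A_def by (auto simp: permutes_inverses[OF d])
  qed (auto simp: permutes_inverses[OF d])
  then have "(\<Sum>h\<in>PiE T (orbit d). \<Sum>x\<in>T. A x h) = (\<Sum>h\<in>PiE T (orbit d). \<Sum>x\<in>T. C x h)"
    by (subst (1 2) sum.swap) (rule sum.cong[OF refl])
  moreover have "(\<Sum>h\<in>PiE T (orbit d). coded_msg V d g (h ` T))
      = (\<Sum>h\<in>PiE T (orbit d). \<Sum>x\<in>T. C x h) + (\<Sum>h\<in>PiE T (orbit d). \<Sum>x\<in>T. A x h)"
    using split by (simp only: sum.distrib[symmetric, where A = "PiE T (orbit d)"] cong: sum.cong)
  ultimately show ?thesis by (simp only: bit_add_self)
qed

lemma card_exchange: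
  assumes "finite W" "y \<in> W" "x \<notin> W"
  shows "card (insert x (W - {y})) = card W"
  using assms card_Suc_Diff1[OF assms(1,2)] by simp

text \<open>Worker \<open>l\<close> reads the symbol \<open>g (d l) W\<close> off the message of the set obtained from \<open>W\<close> by
  exchanging \<open>d l\<close> for \<open>l\<close>: every other term of that message involves a set containing \<open>l\<close>.\<close>

lemma coded_msg_exchange:
  assumes V: "finite V" and d: "d permutes V" and l: "l \<in> V" and W: "W \<subseteq> V" "d l \<in> W" "l \<notin> W"
    and known: "\<And>x W'. W' \<subseteq> V \<Longrightarrow> x \<in> W' \<Longrightarrow> l \<in> W' \<Longrightarrow> card W' = card W \<Longrightarrow> g x W' = 0"
  shows "coded_msg V d g (insert l (W - {d l})) = g (d l) W"
proof -
  let ?T = "insert l (W - {d l})"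
  have fW: "finite W" using V W finite_subset by auto
  have TV: "?T \<subseteq> V" using W l by auto
  have cT: "card ?T = card W"
    by (rule card_exchange[OF fW W(2,3)])
  have dl: "d l \<noteq> l" using W by auto
  have "(\<Sum>y\<in>?T. if inv d y \<notin> ?T then g y ?T else 0) = 0"
    by (rule sum.neutral) (use TV cT in \<open>auto intro!: known\<close>)
  moreover have "(\<Sum>k\<in>V - ?T. if d i \<in> insert k ?T - {i} then g (d i) (insert k ?T - {i}) else 0) = 0"
    if i: "i \<in> ?T" "i \<noteq> l" for i
  proof (rule sum.neutral, clarsimp, intro known)
    fix k assume k: "k \<in> V" "k \<noteq> l" "k \<in> W \<longrightarrow> k = d l" 
    have kn: "k \<notin> ?T" using k by auto
    show "insert k ?T - {i} \<subseteq> V" using TV k by auto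
    show "l \<in> insert k ?T - {i}" using i by auto
    have "card (insert k ?T) = Suc (card ?T)" using kn fW by (intro card_insert_disjoint) auto
    then show "card (insert k ?T - {i}) = card W"
      using i kn fW cT by simp
  qed auto
  moreover have "(\<Sum>k\<in>V - ?T. if d l \<in> insert k ?T - {l} then g (d l) (insert k ?T - {l}) else 0)
      = (\<Sum>k\<in>V - ?T. if k = d l then g (d l) W else 0)"
  proof (rule sum.cong[OF refl])
    fix k assume "k \<in> V - ?T"
    moreover have "insert (d l) ?T - {l} = W" using W dl by auto
    ultimately show "(if d l \<in> insert k ?T - {l} then g (d l) (insert k ?T - {l}) else 0)
        = (if k = d l then g (d l) W else 0)"
      using W dl by (cases "k = d l") simp_all
  qed
  moreover have "\<dots> = g (d l) W"
  proof -
    have "d l \<in> V - ?T" using W dl by auto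
    then show ?thesis using V by simp
  qed
  ultimately show ?thesis
    using coded_msg_alt[OF V d TV, of g] fW
      sum.remove[of ?T l "\<lambda>i. \<Sum>k\<in>V - ?T. if d i \<in> insert k ?T - {i} then g (d i) (insert k ?T - {i}) else 0"]
    by simp
qed

text \<open>Hence the messages indexed by subsets of \<open>R - {r}\<close> (a transversal relation expresses each of
  them by other ones) and by sets containing \<open>r\<close> (a boundary relation) need not be sent.\<close>

lemma coded_msg_zero_all:
  assumes V: "finite V" and d: "d permutes V" and R: "R \<subseteq> V" "inj_on (orbit d) R" "r \<in> R"
    and zero: "\<And>T. T \<subseteq> V - {r} \<Longrightarrow> card T = s \<Longrightarrow> \<not> T \<subseteq> R - {r} \<Longrightarrow> coded_msg V d g T = 0"
    and s: "s \<ge> 1" and T: "T \<subseteq> V" "card T = s"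
  shows "coded_msg V d g T = 0"
proof -
  have perm: "permutation d" using V d permutation_permutes by blast
  have orb_self: "x \<in> orbit d x" for x using permutation_self_in_orbit[OF perm] .
  have avoid: "coded_msg V d g T = 0" if T: "T \<subseteq> V - {r}" "card T = s" for T
  proof (cases "T \<subseteq> R - {r}")
    case True
    have fT: "finite T" using T V finite_subset by (metis finite_Diff)
    have injT: "inj_on (orbit d) T" using R True inj_on_subset by blast
    let ?e = "restrict id T"
    have e: "?e \<in> PiE T (orbit d)" using orb_self by auto
    have fin: "finite (PiE T (orbit d))"
      by (intro finite_PiE fT finite_orbit orb_self)
    \<comment> \<open>Any choice other than \<open>?e\<close> contains a point outside
      \<open>R\<close>, as \<open>R\<close> has at most one point per cycle, and it misses the cycle
      of \<open>r\<close>. Its message is among those assumed to be zero.\<close>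
    have z: "coded_msg V d g (h ` T) = 0" if h: "h \<in> PiE T (orbit d) - {?e}" for h
    proof -
      have orb: "orbit d (h x) = orbit d x" if "x \<in> T" for x
        using that h orbit_eq_iff[OF perm] by auto
      have injh: "inj_on h T"
        by (rule inj_onI) (metis orb injT inj_onD)
      have "h \<noteq> ?e" using h by auto
      then obtain x where x: "x \<in> T" "h x \<noteq> x"
        using h by (auto simp: fun_eq_iff PiE_iff extensional_def restrict_def split: if_splits)
      have "h x \<notin> R"
        using orb[OF x(1)] x True R(2) by (metis DiffD1 inj_onD subsetD)
      moreover have "h ` T \<subseteq> V" using h T permutes_orbit_subset[OF d] by fastforce
      moreover have "r \<notin> h ` T"
      proof
        assume "r \<in> h ` T"
        then obtain y where y: "y \<in> T" "r = h y" by auto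
        then have "orbit d r = orbit d y" using orb by auto
        then have "r = y" using True R y by (metis DiffD1 inj_onD subsetD)
        then show False using T y by auto
      qed
      moreover have "card (h ` T) = s" using card_image[OF injh] T by auto
      ultimately show ?thesis using x by (intro zero) auto
    qed
    have "0 = (\<Sum>h\<in>PiE T (orbit d). coded_msg V d g (h ` T))"
      using sum_coded_msg_transversal[OF V d _ injT, of g] T by auto
    also have "\<dots> = coded_msg V d g (?e ` T)"
      using sum.remove[OF fin e, of "\<lambda>h. coded_msg V d g (h ` T)"] z by simp
    finally show ?thesis by simp
  qed (use zero T in auto)
  show ?thesis
  proof (cases "r \<in> T")
    case True
    \<comment> \<open>The boundary relation at \<open>T - {r}\<close> expresses the message of
      \<open>T\<close> by messages of sets that avoid \<open>r\<close>.\<close>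
    let ?C = "T - {r}"
    have fT: "finite T" using T V finite_subset by auto
    have r: "r \<in> V - ?C" using R by auto
    have "0 = (\<Sum>i\<in>V - ?C. coded_msg V d g (insert i ?C))"
      using sum_coded_msg_insert[OF V] by metis
    also have "\<dots> = coded_msg V d g (insert r ?C)
        + (\<Sum>i\<in>V - ?C - {r}. coded_msg V d g (insert i ?C))"
      by (rule sum.remove[OF _ r]) (use V in auto)
    also have "(\<Sum>i\<in>V - ?C - {r}. coded_msg V d g (insert i ?C)) = 0"
    proof (rule sum.neutral, intro ballI avoid)
      fix i assume i: "i \<in> V - ?C - {r}"
      show "insert i ?C \<subseteq> V - {r}" using i T by auto
      show "card (insert i ?C) = s" using card_exchange[OF fT True, of i] i T by auto
    qed
    finally show ?thesis using True by (simp add: insert_absorb)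
  qed (use avoid T in auto)
qed

text \<open>The kernel form of decodability: \<open>zero\<close> says that the transmitted messages
  vanish, \<open>known\<close> that the parts available to \<open>l\<close> vanish. Only parts of
  the same size as \<open>W\<close> are involved.\<close>

lemma coded_msg_decode:
  assumes V: "finite V" and d: "d permutes V" and R: "R \<subseteq> V" "inj_on (orbit d) R" "r \<in> R"
    and zero: "\<And>T. T \<subseteq> V - {r} \<Longrightarrow> card T = card W \<Longrightarrow> \<not> T \<subseteq> R - {r} \<Longrightarrow> coded_msg V d g T = 0"
    and l: "l \<in> V" and W: "W \<subseteq> V" "d l \<in> W"
    and known: "\<And>x W'. W' \<subseteq> V \<Longrightarrow> x \<in> W' \<Longrightarrow> l \<in> W' \<Longrightarrow> card W' = card W \<Longrightarrow> g x W' = 0"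
  shows "g (d l) W = 0"
proof (cases "l \<in> W")
  case False
  have fW: "finite W" using V W finite_subset by auto
  let ?T = "insert l (W - {d l})"
  have "coded_msg V d g ?T = 0"
  proof (rule coded_msg_zero_all[OF V d R zero])
    show "card W \<ge> 1" using W fW by (metis One_nat_def Suc_leI card_gt_0_iff empty_iff)
    show "?T \<subseteq> V" using W l by auto
    show "card ?T = card W" by (rule card_exchange[OF fW W(2) False])
  qed auto
  moreover have "coded_msg V d g ?T = g (d l) W"
    by (rule coded_msg_exchange[OF V d l W False]) (rule known)
  ultimately show ?thesis by (simp only:)
qed (use W known in auto)

section \<open>Cycles of the file transition graph\<close>

text \<open>The arc of a file leaves its owner and every worker owns one file, so a walk is
  determined by its start and its length.\<close>

lemma awalk_transition_graph:
  assumes "pre_digraph.cas (transition_graph K d) u p v"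
  shows "p = map (\<lambda>n. (inv d ^^ n) u) [0..<length p] \<and> v = (inv d ^^ length p) u"
  using assms
proof (induction p arbitrary: u)
  case Nil
  then show ?case by (simp add: pre_digraph.cas.simps)
next
  case (Cons a p)
  then have a: "a = u" and p: "pre_digraph.cas (transition_graph K d) (inv d u) p v"
    by (auto simp: pre_digraph.cas.simps transition_graph_def)
  have "map (\<lambda>n. (inv d ^^ n) u) [0..<Suc (length p)] = u # map (\<lambda>n. (inv d ^^ n) (inv d u)) [0..<length p]"
    by (simp add: map_upt_Suc funpow_swap1 del: upt_Suc)
  then show ?case using Cons.IH[OF p] a by (simp add: funpow_swap1 del: upt_Suc)
qed

lemma cas_transition_graph:
  "pre_digraph.cas (transition_graph K d) u (map (\<lambda>n. (inv d ^^ n) u) [0..<m]) ((inv d ^^ m) u)"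
proof (induction m arbitrary: u)
  case 0
  then show ?case by (simp add: pre_digraph.cas.simps)
next
  case (Suc m)
  have "map (\<lambda>n. (inv d ^^ n) u) [0..<Suc m] = u # map (\<lambda>n. (inv d ^^ n) (inv d u)) [0..<m]"
    by (simp add: map_upt_Suc funpow_swap1 del: upt_Suc)
  then show ?case
    using Suc[of "inv d u"]
    by (simp add: pre_digraph.cas.simps transition_graph_def funpow_swap1 del: upt_Suc)
qed

text \<open>Arcs are named by their tails, so the arc set of a cycle through \<open>u\<close> is the
  orbit of \<open>u\<close> under \<open>inv d\<close>, which is also its orbit under
  \<open>d\<close>.\<close>

lemma num_cycles_transition_graph:
  assumes d: "d permutes {1..K}"
  shows "num_cycles (transition_graph K d) = card (orbit d ` {1..K})"
proof -
  let ?G = "transition_graph K d" and ?e = "inv d"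
  have perm: "permutation d" using d permutation_permutes by blast
  have self: "u \<in> orbit ?e u" for u
    using permutation_self_in_orbit[OF perm] orbit_inv_eq[OF perm] by metis
  have "{set p |p. pre_digraph.cycle ?G p} = orbit d ` {1..K}"
  proof (intro equalityI subsetI)
    fix A assume "A \<in> {set p |p. pre_digraph.cycle ?G p}"
    then obtain p u where A: "A = set p" and p: "pre_digraph.awalk ?G u p u" "p \<noteq> []"
      by (auto simp: pre_digraph.cycle_def)
    then have u: "u \<in> {1..K}" and cas: "pre_digraph.cas ?G u p u"
      by (auto simp: pre_digraph.awalk_def transition_graph_def)
    note w = awalk_transition_graph[OF cas]
    have "set p = {(?e ^^ n) u | n. n < length p}"
      by (subst w[THEN conjunct1]) auto
    also have "\<dots> = orbit ?e u"
      using orbit_altdef_bounded[of "length p" ?e u] w p(2) by auto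
    finally show "A \<in> orbit d ` {1..K}" using A u orbit_inv_eq[OF perm] by auto
  next
    fix A assume "A \<in> orbit d ` {1..K}"
    then obtain u where u: "u \<in> {1..K}" and A: "A = orbit ?e u"
      using orbit_inv_eq[OF perm] by auto
    \<comment> \<open>The first return time to \<open>u\<close>: the walk of this length closes up
      and repeats no arc.\<close>
    define m where "m = funpow_dist1 ?e u u"
    define p where "p = map (\<lambda>n. (?e ^^ n) u) [0..<m]"
    have m: "m > 0" "(?e ^^ m) u = u"
      using funpow_dist1_prop[OF self] by (auto simp: m_def)
    have setp: "set p = A" by (simp only: orbit_conv_funpow_dist1[OF self] A p_def m_def set_map set_upt)
    have inj: "inj_on (\<lambda>n. (?e ^^ n) u) {0..<m}"
      unfolding m_def by (rule inj_on_funpow_dist1[OF self])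
    have "A \<subseteq> {1..K}" using permutes_orbit_subset[OF d u] A orbit_inv_eq[OF perm] by auto
    then have aw: "pre_digraph.awalk ?G u p u"
      using u setp cas_transition_graph[of K d u m] m
      by (auto simp: pre_digraph.awalk_def p_def transition_graph_def)
    have cas: "pre_digraph.cas ?G u p u"
      using cas_transition_graph[of K d u m] m by (simp add: p_def)
    have pne: "p \<noteq> []" using m by (simp add: p_def)
    have "tl (pre_digraph.awalk_verts ?G u p) = map ?e p"
      using pre_digraph.awalk_verts_conv'[OF cas] pne by (simp add: transition_graph_def)
    moreover have "distinct (map ?e p)"
    proof -
      have "distinct p" by (simp add: p_def distinct_map inj)
      moreover have "inj_on ?e (set p)"
        by (rule inj_on_subset[OF permutes_inj[OF permutes_inv[OF d]]]) simp
      ultimately show ?thesis by (simp add: distinct_map)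
    qed
    ultimately have "pre_digraph.cycle ?G p"
      using aw pne by (auto simp: pre_digraph.cycle_def)
    then show "A \<in> {set p |p. pre_digraph.cycle ?G p}" using setp by auto
  qed
  then show ?thesis by (simp add: num_cycles_def)
qed

text \<open>Arcs are named by their tails, so the arc map of an isomorphism agrees with its vertex
  map, and compatibility with the heads says that the vertex map conjugates \<open>inv d\<close>
  into \<open>inv d0\<close>.\<close>

lemma assignments_of_transition_graph:
  assumes d0: "d0 permutes {1..K}"
  shows "assignments_of K (transition_graph K d0) = (\<lambda>\<pi>. \<pi> \<circ> d0 \<circ> inv \<pi>) ` {\<pi>. \<pi> permutes {1..K}}"
proof (intro equalityI subsetI)
  fix d assume "d \<in> assignments_of K (transition_graph K d0)"
  then obtain f where d: "d permutes {1..K}"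
    and f: "pre_digraph.digraph_isomorphism (transition_graph K d) f"
    and G: "transition_graph K d0 = app_iso f (transition_graph K d)"
    by (auto simp: assignments_of_def digraph_iso_def)
  let ?h = "iso_verts f"
  have inj: "inj_on ?h {1..K}" and tl: "\<And>a. a \<in> {1..K} \<Longrightarrow> ?h a = iso_tail f (iso_arcs f a)"
    and hd: "\<And>a. a \<in> {1..K} \<Longrightarrow> ?h (inv d a) = iso_head f (iso_arcs f a)"
    using f by (auto simp: pre_digraph.digraph_isomorphism_def transition_graph_def)
  have im: "?h ` {1..K} = {1..K}" and tf: "iso_tail f = (\<lambda>j. j)" and hf: "iso_head f = inv d0"
    using G by (auto simp: app_iso_def transition_graph_def)
  \<comment> \<open>An isomorphism is unconstrained outside the vertex set; the identity is taken
    there, to obtain a permutation in the sense of \<open>permutes\<close>.\<close>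
  define \<sigma> where "\<sigma> x = (if x \<in> {1..K} then ?h x else x)" for x
  have \<sigma>: "\<sigma> permutes {1..K}"
  proof (rule bij_imp_permutes)
    have "bij_betw \<sigma> {1..K} {1..K} \<longleftrightarrow> bij_betw ?h {1..K} {1..K}"
      by (rule bij_betw_cong) (simp add: \<sigma>_def)
    then show "bij_betw \<sigma> {1..K} {1..K}" using inj im by (simp add: bij_betw_def)
  next
    fix x assume "x \<notin> {1..K}"
    then show "\<sigma> x = x" by (simp only: \<sigma>_def if_False)
  qed
  have comm: "\<sigma> (inv d x) = inv d0 (\<sigma> x)" for x
  proof (cases "x \<in> {1..K}")
    case True
    then have "inv d x \<in> {1..K}" using permutes_in_image[OF permutes_inv[OF d]] by blast
    then show ?thesis using True tl[OF True] hd[OF True] tf hf by (simp add: \<sigma>_def)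
  next
    case False
    then show ?thesis
      using permutes_not_in[OF permutes_inv[OF d]] permutes_not_in[OF permutes_inv[OF d0]]
        permutes_not_in[OF \<sigma>] by metis
  qed
  have "d = inv \<sigma> \<circ> d0 \<circ> inv (inv \<sigma>)"
  proof
    fix y
    have "\<sigma> y = inv d0 (\<sigma> (d y))" using comm[of "d y"] permutes_inverses[OF d] by simp
    then have "d0 (\<sigma> y) = \<sigma> (d y)" using permutes_inverses[OF d0] by simp
    then show "d y = (inv \<sigma> \<circ> d0 \<circ> inv (inv \<sigma>)) y"
      using permutes_inverses[OF \<sigma>] permutes_inv_inv[OF \<sigma>] by simp
  qed
  then show "d \<in> (\<lambda>\<pi>. \<pi> \<circ> d0 \<circ> inv \<pi>) ` {\<pi>. \<pi> permutes {1..K}}"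
    using permutes_inv[OF \<sigma>] by blast
next
  fix d assume "d \<in> (\<lambda>\<pi>. \<pi> \<circ> d0 \<circ> inv \<pi>) ` {\<pi>. \<pi> permutes {1..K}}"
  then obtain \<pi> where \<pi>: "\<pi> permutes {1..K}" and dd: "d = \<pi> \<circ> d0 \<circ> inv \<pi>" by auto
  have d: "d permutes {1..K}"
    unfolding dd by (intro permutes_compose permutes_inv \<pi> d0)
  have invd: "inv d = \<pi> \<circ> inv d0 \<circ> inv \<pi>"
    by (rule inv_unique_comp) (auto simp: fun_eq_iff dd permutes_inverses[OF \<pi>] permutes_inverses[OF d0])
  let ?f = "\<lparr>iso_verts = inv \<pi>, iso_arcs = inv \<pi>, iso_head = inv d0, iso_tail = (\<lambda>j. j)\<rparr>"
  have "pre_digraph.digraph_isomorphism (transition_graph K d) ?f"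
    using permutes_inj[OF permutes_inv[OF \<pi>]] permutes_in_image[OF permutes_inv[OF d]]
    by (auto simp: pre_digraph.digraph_isomorphism_def transition_graph_def wf_digraph_def inj_on_def
        invd permutes_inverses[OF \<pi>])
  moreover have "transition_graph K d0 = app_iso ?f (transition_graph K d)"
    using permutes_image[OF permutes_inv[OF \<pi>]] by (auto simp: app_iso_def transition_graph_def)
  ultimately show "d \<in> assignments_of K (transition_graph K d0)"
    using d unfolding assignments_of_def digraph_iso_def by blast
qed

lemma card_orbits_conj:
  assumes d: "d permutes V" and \<pi>: "\<pi> permutes V" and V: "finite V"
  shows "card (orbit (\<pi> \<circ> d \<circ> inv \<pi>) ` V) = card (orbit d ` V)"
proof -
  have perm: "permutation d" using V d permutation_permutes by blast
  have orb: "orbit (\<pi> \<circ> d \<circ> inv \<pi>) (\<pi> x) = \<pi> ` orbit d x" for x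
    by (rule orbit_inverse[symmetric])
      (auto simp: permutation_self_in_orbit[OF perm] permutes_inverses[OF \<pi>])
  have "orbit (\<pi> \<circ> d \<circ> inv \<pi>) ` V = orbit (\<pi> \<circ> d \<circ> inv \<pi>) ` \<pi> ` V"
    using permutes_image[OF \<pi>] by simp
  also have "\<dots> = image \<pi> ` (orbit d ` V)" by (auto simp: orb image_image)
  finally show ?thesis
    using card_image[of "image \<pi>" "orbit d ` V"] permutes_inj[OF \<pi>]
    by (simp add: inj_on_def inj_image_eq_iff)
qed

lemma orbit_representatives:
  obtains R where "R \<subseteq> V" "inj_on (orbit d) R" "orbit d ` R = orbit d ` V"
    "card R = card (orbit d ` V)"
proof -
  obtain R where "R \<subseteq> V" "inj_on (orbit d) R" "orbit d ` V = orbit d ` R"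
    using subset_image_inj[of "orbit d ` V" "orbit d" V] by auto
  then show ?thesis using that card_image by metis
qed

text \<open>Removing one worker from each cycle leaves directed paths. Along them the files are decoded
  one after the other.\<close>

lemma acyclic_order:
  assumes d: "d permutes V" and V: "finite V"
  obtains us where "distinct us" "set us \<subseteq> V" "length us = card V - card (orbit d ` V)"
    "\<And>j k. k < length us \<Longrightarrow> j \<le> k \<Longrightarrow> d (us ! k) \<noteq> us ! j"
proof -
  have perm: "permutation d" using V d permutation_permutes by blast
  obtain R where R: "R \<subseteq> V" "inj_on (orbit d) R" "orbit d ` R = orbit d ` V"
    "card R = card (orbit d ` V)" by (rule orbit_representatives)
  \<comment> \<open>The number of steps from \<open>x\<close> along \<open>d\<close> to a
    representative. It drops along \<open>d\<close> on the remaining workers, so listing them by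
    decreasing \<open>\<rho>\<close> puts the owner of each requested file later or leaves it among
    the representatives.\<close>
  define \<rho> where "\<rho> x = (LEAST n. (d ^^ n) x \<in> R)" for x
  have \<rho>: "(d ^^ \<rho> x) x \<in> R" if x: "x \<in> V" for x
  proof -
    obtain y where y: "y \<in> R" "orbit d x = orbit d y" using R(3) x by (metis image_iff)
    then have "y \<in> orbit d x" using permutation_self_in_orbit[OF perm] by auto
    then have "\<exists>n. (d ^^ n) x \<in> R" using y(1) orbit_altdef[of d x] by auto
    then show ?thesis unfolding \<rho>_def by (rule LeastI_ex)
  qed
  have dec: "\<rho> (d x) < \<rho> x" if x: "x \<in> V - R" for x
  proof -
    have "\<rho> x \<noteq> 0" using \<rho>[of x] x by (auto intro: ccontr)
    then obtain n where n: "\<rho> x = Suc n" using not0_implies_Suc by blast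
    then have "(d ^^ n) (d x) \<in> R" using \<rho>[of x] x by (simp add: funpow_swap1)
    then have "\<rho> (d x) \<le> n" unfolding \<rho>_def by (rule Least_le)
    then show ?thesis using n by simp
  qed
  obtain ws where ws: "set ws = V - R" "distinct ws" using finite_distinct_list[of "V - R"] V by auto
  define us where "us = rev (sort_key \<rho> ws)"
  have us: "set us = V - R" "distinct us" using ws by (auto simp: us_def)
  have mono: "\<rho> (us ! k) \<le> \<rho> (us ! j)" if "j \<le> k" "k < length us" for j k
  proof -
    let ?xs = "sort_key \<rho> ws"
    have "sorted (map \<rho> ?xs)" by simp
    then have "\<rho> (?xs ! (length us - Suc k)) \<le> \<rho> (?xs ! (length us - Suc j))"
      using sorted_nth_mono[of "map \<rho> ?xs" "length us - Suc k" "length us - Suc j"] that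
      by (simp add: us_def)
    then show ?thesis using that by (simp add: us_def rev_nth)
  qed
  show ?thesis
  proof (rule that)
    show "distinct us" "set us \<subseteq> V" using us by auto
    show "length us = card V - card (orbit d ` V)"
      using us R(1,4) V distinct_card[of us] card_Diff_subset[OF finite_subset[OF R(1) V] R(1)] by simp
    fix j k assume k: "k < length us" and j: "j \<le> k"
    have "us ! k \<in> V - R" using us(1) k nth_mem by blast
    then show "d (us ! k) \<noteq> us ! j" using dec[of "us ! k"] mono[OF j k] by auto
  qed
qed

section \<open>Lower bound for a fixed assignment\<close>

text \<open>The decoder returns the value at any argument consistent with the message and the cache;
  it is enough that these two determine the value.\<close>

lemma ex_decoder:
  assumes "\<And>x y. x \<in> S \<Longrightarrow> y \<in> S \<Longrightarrow> m x = m y \<Longrightarrow> c x = c y \<Longrightarrow> f x = f y"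
  shows "\<exists>decode. \<forall>x\<in>S. f x = decode (m x) (c x)"
proof -
  have "\<forall>x\<in>S. f x = f (SOME y. y \<in> S \<and> m y = m x \<and> c y = c x)"
  proof
    fix x assume x: "x \<in> S"
    let ?y = "SOME y. y \<in> S \<and> m y = m x \<and> c y = c x"
    have "?y \<in> S \<and> m ?y = m x \<and> c ?y = c x"
      by (rule someI[of _ x]) (use x in simp)
    then show "f x = f ?y" using assms x by metis
  qed
  then show ?thesis by (intro exI[of _ "\<lambda>a b. f (SOME y. y \<in> S \<and> m y = a \<and> c y = b)"])
qed

lemma file_tuplesD:
  assumes "F \<in> file_tuples K B" "i \<in> {1..K}"
  shows "length (F i) = B"
  using assms by (auto simp: file_tuples_def PiE_iff)

text \<open>Broadcasting all files works for every placement. This makes the \<open>LEAST\<close> in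
  \<open>min_load\<close> range over a nonempty set.\<close>

lemma ex_delivery:
  assumes d: "d permutes {1..K}"
  shows "\<exists>L X. is_delivery K B P d L X"
proof (intro exI)
  let ?X = "\<lambda>F. concat (map F [1..<Suc K])"
  have len: "length (F i) = B" if "F \<in> file_tuples K B" "i \<in> set [1..<Suc K]" for F i
    using file_tuplesD[OF that(1)] that(2) by auto
  show "is_delivery K B P d (K * B) ?X"
    unfolding is_delivery_def
  proof (intro conjI ballI ex_decoder)
    fix F assume F: "F \<in> file_tuples K B"
    have "length (?X F) = sum_list (map (\<lambda>i. B) [1..<Suc K])"
      unfolding length_concat map_map o_def
      by (intro arg_cong[of _ _ sum_list] map_cong refl len[OF F])
    also have "\<dots> = K * B" by (simp only: sum_list_triv length_upt) simp
    finally show "length (?X F) = K * B" .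
  next
    fix i F F' assume i: "i \<in> {1..K}" and F: "F \<in> file_tuples K B" and F': "F' \<in> file_tuples K B"
      and eq: "?X F = ?X F'"
    have "map F [1..<Suc K] = map F' [1..<Suc K]"
    proof (rule concat_injective[OF eq])
      show "\<forall>(x, y)\<in>set (zip (map F [1..<Suc K]) (map F' [1..<Suc K])). length x = length y"
        using len[OF F] len[OF F'] by (auto simp: set_zip simp del: upt_Suc)
    qed simp
    moreover have "d i \<in> set [1..<Suc K]" using i permutes_in_image[OF d, of i] by auto
    ultimately show "F (d i) = F' (d i)" by (metis map_eq_conv)
  qed
qed

lemma min_load_attained:
  assumes "d permutes {1..K}"
  obtains L X where "is_delivery K B P d L X" "min_load K B P d = real L / real B"
  using LeastI_ex[OF ex_delivery[OF assms, of B P]] unfolding min_load_def by blast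

lemma min_load_nonneg: "min_load K B P d \<ge> 0"
  by (simp add: min_load_def)

lemma min_load_le:
  assumes "is_delivery K B P d L X"
  shows "min_load K B P d \<le> real L / real B"
proof -
  have "(LEAST L. \<exists>X. is_delivery K B P d L X) \<le> L" using assms by (intro Least_le) blast
  then show ?thesis by (simp add: min_load_def divide_right_mono)
qed

text \<open>Along \<open>us\<close>, a receiver that knows the message decodes the files \<open>d (us ! k)\<close> one after the
  other. Hence the message determines all bits of these files that are not cached by the workers
  visited so far, when the other bits are set to zero.\<close>

lemma delivery_length_ge:
  assumes X: "is_delivery K B P d L X" and d: "d permutes {1..K}"
    and P: "uncoded_placement K S B P"
    and us: "distinct us" "set us \<subseteq> {1..K}"
    and ord: "\<And>j k. k < length us \<Longrightarrow> j \<le> k \<Longrightarrow> d (us ! k) \<noteq> us ! j"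
  shows "(\<Sum>k<length us. card {b\<in>{..<B}. \<forall>j\<le>k. b \<notin> P (d (us ! k)) (us ! j)}) \<le> L"
proof -
  define N where "N k = {b\<in>{..<B}. \<forall>j\<le>k. b \<notin> P (d (us ! k)) (us ! j)}" for k
  \<comment> \<open>\<open>E\<close> collects the bits that are new along \<open>us\<close>; for
    \<open>A \<subseteq> E\<close>, \<open>F A\<close> is the file tuple whose ones are exactly
    \<open>A\<close>. Injectivity of the message on these tuples yields
    \<open>2 ^ card E \<le> 2 ^ L\<close>.\<close>
  define E where "E = (\<Union>k<length us. {d (us ! k)} \<times> N k)"
  define F where "F A = (\<lambda>i\<in>{1..K}. map (\<lambda>b. (i, b) \<in> A) [0..<B])" for A :: "(nat \<times> nat) set"
  have injd: "d (us ! j) = d (us ! k) \<longleftrightarrow> j = k" if "j < length us" "k < length us" for j k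
    using that us(1) permutes_inj[OF d] nth_eq_iff_index_eq by (metis injD)
  have finN: "finite (N k)" for k by (simp add: N_def)
  have finE: "finite E" using finN by (auto simp: E_def)
  have cardE: "card E = (\<Sum>k<length us. card (N k))"
    unfolding E_def by (subst card_UN_disjoint) (auto simp: finN injd card_cartesian_product)
  have F: "F A \<in> file_tuples K B" for A by (auto simp: F_def file_tuples_def)
  have nth: "F A i ! b = ((i, b) \<in> A)" if "i \<in> {1..K}" "b < B" for A i b
    using that by (simp add: F_def)
  have memE: "k < length us \<and> b \<in> N k" if "(d (us ! k), b) \<in> E" "k < length us" for k b
    using that injd by (auto simp: E_def)
  have inj: "inj_on (\<lambda>A. X (F A)) (Pow E)"
  proof (rule inj_onI)
    fix A A' assume A: "A \<in> Pow E" and A': "A' \<in> Pow E" and eq: "X (F A) = X (F A')"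
    have step: "F A (d (us ! k)) = F A' (d (us ! k))" if "k < length us" for k
      using that
    proof (induction k rule: less_induct)
      case (less k)
      let ?u = "us ! k"
      have u: "?u \<in> {1..K}" using us less.prems nth_mem by blast
      \<comment> \<open>A bit of \<open>E\<close> that \<open>?u\<close> sees belongs to a file
        decoded earlier: at the current and later steps, \<open>ord\<close> excludes the own file of
        \<open>?u\<close> and the definition of \<open>N\<close> excludes its cached bits. Bits
        outside \<open>E\<close> are zero.\<close>
      have known: "((i, b) \<in> A) = ((i, b) \<in> A')"
        if i: "i \<in> {1..K}" "b < B" and ib: "i = ?u \<or> b \<in> P i ?u" for i b
      proof (cases "(i, b) \<in> E")
        case True
        then obtain j where j: "j < length us" "i = d (us ! j)" "b \<in> N j" by (auto simp: E_def)
        have "j < k"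
        proof (rule ccontr)
          assume "\<not> j < k"
          then have "k \<le> j" by simp
          then show False using ib j ord[OF j(1), of k] by (auto simp: N_def)
        qed
        then have "F A i = F A' i" using less.IH j by simp
        then show ?thesis using nth[OF i] by metis
      next
        case False
        then show ?thesis using A A' by auto
      qed
      have "F A ?u = F A' ?u"
        using known[of ?u] u by (auto simp: F_def)
      moreover have "(if i \<in> {1..K} - {?u} \<and> b \<in> P i ?u then Some (F A i ! b) else None)
          = (if i \<in> {1..K} - {?u} \<and> b \<in> P i ?u then Some (F A' i ! b) else None)" for i b
      proof (cases "i \<in> {1..K} - {?u} \<and> b \<in> P i ?u")
        case True
        then have "b < B" using P u unfolding uncoded_placement_def by blast
        then show ?thesis using True nth known by auto
      next
        case False
        then show ?thesis by (simp only: if_False)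
      qed
      ultimately have "cache K P ?u (F A) = cache K P ?u (F A')"
        unfolding cache_def by auto
      moreover obtain decode where "\<forall>F\<in>file_tuples K B. F (d ?u) = decode (X F) (cache K P ?u F)"
        using X u unfolding is_delivery_def by blast
      ultimately show ?case using eq F by metis
    qed
    have "((i, b) \<in> A) = ((i, b) \<in> A')" if ib: "(i, b) \<in> E" for i b
    proof -
      obtain k where k: "k < length us" "i = d (us ! k)" "b \<in> N k" using ib by (auto simp: E_def)
      have "us ! k \<in> {1..K}" using us k(1) nth_mem by blast
      then have "i \<in> {1..K}" using k permutes_in_image[OF d] by simp
      moreover have "b < B" using k by (auto simp: N_def)
      ultimately show ?thesis using nth step[OF k(1)] k(2) by metis
    qed
    then show "A = A'" using A A' by auto
  qed
  have "2 ^ card E = card ((\<lambda>A. X (F A)) ` Pow E)"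
    using card_image[OF inj] card_Pow[OF finE] by simp
  also have "\<dots> \<le> card {w :: bool list. set w \<subseteq> UNIV \<and> length w = L}"
    by (rule card_mono[OF finite_lists_length_eq]) (use X F in \<open>auto simp: is_delivery_def\<close>)
  also have "\<dots> = 2 ^ L" by (subst card_lists_length_eq) auto
  finally show ?thesis using cardE by (simp add: N_def)
qed

section \<open>Counting permutations by the images of a point and a set\<close>

lemma ex_permutation_mapping:
  assumes V: "finite V" and i: "i \<in> V" "A \<subseteq> V - {i}" and i': "i' \<in> V" "A' \<subseteq> V - {i'}"
    and card: "card A = card A'"
  obtains \<sigma> where "\<sigma> permutes V" "\<sigma> i = i'" "\<sigma> ` A = A'"
proof -
  have fin: "finite A" "finite A'" using assms finite_subset by (metis finite_Diff)+
  obtain h where h: "bij_betw h A A'"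
    using finite_same_card_bij[OF fin card] by blast
  have "card (V - {i} - A) = card (V - {i'} - A')"
    using assms fin by (simp add: card_Diff_subset)
  then obtain h' where h': "bij_betw h' (V - {i} - A) (V - {i'} - A')"
    using finite_same_card_bij V by (metis finite_Diff)
  define \<sigma> where "\<sigma> x = (if x = i then i' else if x \<in> A then h x else if x \<in> V then h' x else x)" for x
  have 1: "bij_betw \<sigma> A A'"
    using h i by (subst bij_betw_cong[of _ _ h]) (auto simp: \<sigma>_def)
  have 2: "bij_betw \<sigma> (V - {i} - A) (V - {i'} - A')"
    using h' by (subst bij_betw_cong[of _ _ h']) (auto simp: \<sigma>_def)
  have 3: "bij_betw \<sigma> {i} {i'}" by (auto simp: \<sigma>_def bij_betw_def)
  have "bij_betw \<sigma> ({i} \<union> (A \<union> (V - {i} - A))) ({i'} \<union> (A' \<union> (V - {i'} - A')))"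
    by (intro bij_betw_combine 1 2 3) (use i' in auto)
  moreover have "{i} \<union> (A \<union> (V - {i} - A)) = V" "{i'} \<union> (A' \<union> (V - {i'} - A')) = V"
    using i i' by auto
  ultimately have "bij_betw \<sigma> V V" by simp
  then have "\<sigma> permutes V" by (rule bij_imp_permutes) (use i in \<open>auto simp: \<sigma>_def\<close>)
  moreover have "\<sigma> ` A = A'" using 1 by (simp add: bij_betw_def)
  ultimately show ?thesis using that by (simp add: \<sigma>_def)
qed

text \<open>The permutations are distributed evenly over the possible values of \<open>\<pi> v\<close> and \<open>\<pi> ` A\<close>.\<close>

lemma card_permutations_avoiding:
  assumes V: "finite V" and v: "v \<in> V" "A \<subseteq> V - {v}" and i: "i \<in> V" "C \<subseteq> V - {i}"
  shows "card {\<pi>. \<pi> permutes V \<and> \<pi> v = i \<and> \<pi> ` A \<inter> C = {}} * (card V * ((card V - 1) choose card A))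
    = fact (card V) * ((card V - 1 - card C) choose card A)"
proof -
  \<comment> \<open>\<open>N p\<close> is the fibre over the pair of images \<open>p\<close>, and
    \<open>Q\<close> is the set of possible pairs. Composition with a permutation carrying one pair
    to another identifies their fibres, so all have size \<open>?c\<close>.\<close>
  define N where "N p = {\<pi>. \<pi> permutes V \<and> \<pi> v = fst p \<and> \<pi> ` A = snd p}" for p
  define Q where "Q = Sigma V (\<lambda>i. {A'. A' \<subseteq> V - {i} \<and> card A' = card A})"
  let ?c = "card (N (v, A))"
  have finN: "finite (N p)" for p
    by (rule finite_subset[OF _ finite_permutations[OF V]]) (auto simp: N_def)
  have cardN: "card (N p) = ?c" if p: "p \<in> Q" for p
  proof -
    obtain j A' where jA: "p = (j, A')" "j \<in> V" "A' \<subseteq> V - {j}" "card A' = card A"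
      using p by (auto simp: Q_def)
    obtain \<sigma> where \<sigma>: "\<sigma> permutes V" "\<sigma> v = j" "\<sigma> ` A = A'"
      using ex_permutation_mapping[OF V v jA(2,3)] jA(4) by metis
    have inv: "inv \<sigma> j = v" "inv \<sigma> ` A' = A"
      using \<sigma> permutes_inverses[OF \<sigma>(1)] by (auto simp: image_image)
    have "bij_betw (\<lambda>\<pi>. \<sigma> \<circ> \<pi>) (N (v, A)) (N p)"
    proof (rule bij_betw_byWitness[where f' = "\<lambda>\<pi>. inv \<sigma> \<circ> \<pi>"])
      show "(\<lambda>\<pi>. \<sigma> \<circ> \<pi>) ` N (v, A) \<subseteq> N p"
      proof (rule image_subsetI)
        fix \<pi> assume "\<pi> \<in> N (v, A)"
        then have \<pi>: "\<pi> permutes V" "\<pi> v = v" "\<pi> ` A = A" by (auto simp: N_def)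
        then have "(\<sigma> \<circ> \<pi>) ` A = A'" using \<sigma>(3) by (metis image_comp)
        then show "\<sigma> \<circ> \<pi> \<in> N p"
          using \<pi> \<sigma> permutes_compose[OF \<pi>(1) \<sigma>(1)] by (simp add: N_def jA(1))
      qed
      show "(\<lambda>\<pi>. inv \<sigma> \<circ> \<pi>) ` N p \<subseteq> N (v, A)"
      proof (rule image_subsetI)
        fix \<pi> assume "\<pi> \<in> N p"
        then have \<pi>: "\<pi> permutes V" "\<pi> v = j" "\<pi> ` A = A'" by (auto simp: N_def jA(1))
        then have "(inv \<sigma> \<circ> \<pi>) ` A = A" using inv(2) by (metis image_comp)
        then show "inv \<sigma> \<circ> \<pi> \<in> N (v, A)"
          using \<pi> inv permutes_compose[OF \<pi>(1) permutes_inv[OF \<sigma>(1)]] by (simp add: N_def)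
      qed
    qed (auto simp: fun_eq_iff permutes_inverses[OF \<sigma>(1)])
    then show ?thesis by (simp add: bij_betw_same_card)
  qed
  have disj: "N p \<inter> N q = {}" if "p \<noteq> q" for p q
    using that by (auto simp: N_def prod_eq_iff)
  have finQ: "finite Q" unfolding Q_def using V by auto
  have cardQ: "card Q = card V * ((card V - 1) choose card A)"
    unfolding Q_def using V by (simp add: n_subsets)
  have "{\<pi>. \<pi> permutes V} = (\<Union>p\<in>Q. N p)"
  proof (intro equalityI subsetI)
    fix \<pi> assume "\<pi> \<in> {\<pi>. \<pi> permutes V}"
    then have \<pi>: "\<pi> permutes V" by simp
    have "(\<pi> v, \<pi> ` A) \<in> Q"
      using v permutes_in_image[OF \<pi>] permutes_inj[OF \<pi>] card_image[OF inj_on_subset[OF permutes_inj[OF \<pi>]], of A]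
      by (auto simp: Q_def dest: injD)
    then show "\<pi> \<in> (\<Union>p\<in>Q. N p)"
      by (rule UN_I) (use \<pi> in \<open>simp add: N_def\<close>)
  qed (auto simp: N_def)
  then have "fact (card V) = (\<Sum>p\<in>Q. card (N p))"
    using card_permutations[OF refl V] card_UN_disjoint[OF finQ, of N] finN disj by simp
  then have tot: "fact (card V) = card Q * ?c" using cardN by simp
  define M where "M = {A'. A' \<subseteq> V - {i} - C \<and> card A' = card A}"
  have finM: "finite M" unfolding M_def using V by auto
  have "finite C" using i(2) V finite_subset by (metis finite_Diff)
  then have cardM: "card M = (card V - 1 - card C) choose card A"
    unfolding M_def using V i by (simp add: n_subsets card_Diff_subset)
  have MQ: "(i, A') \<in> Q" if "A' \<in> M" for A' using that i by (auto simp: M_def Q_def)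
  have "{\<pi>. \<pi> permutes V \<and> \<pi> v = i \<and> \<pi> ` A \<inter> C = {}} = (\<Union>A'\<in>M. N (i, A'))"
  proof (intro equalityI subsetI)
    fix \<pi> assume "\<pi> \<in> {\<pi>. \<pi> permutes V \<and> \<pi> v = i \<and> \<pi> ` A \<inter> C = {}}"
    then have \<pi>: "\<pi> permutes V" "\<pi> v = i" "\<pi> ` A \<inter> C = {}" by auto
    have "\<pi> ` A \<in> M"
      using v \<pi> permutes_in_image[OF \<pi>(1)] permutes_inj[OF \<pi>(1)]
        card_image[OF inj_on_subset[OF permutes_inj[OF \<pi>(1)]], of A]
      by (auto simp: M_def dest: injD)
    then show "\<pi> \<in> (\<Union>A'\<in>M. N (i, A'))" using \<pi> by (auto simp: N_def)
  qed (auto simp: N_def M_def)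
  then have "card {\<pi>. \<pi> permutes V \<and> \<pi> v = i \<and> \<pi> ` A \<inter> C = {}} = (\<Sum>A'\<in>M. card (N (i, A')))"
    using card_UN_disjoint[OF finM, of "\<lambda>A'. N (i, A')"] finN disj by simp
  also have "\<dots> = card M * ?c" using cardN MQ by simp
  finally show ?thesis using tot cardM cardQ by simp
qed

section \<open>Convexity of the corner loads\<close>

text \<open>After clearing denominators, both sides count the pairs of disjoint subsets of sizes
  \<open>t\<close> and \<open>k\<close> of an \<open>n\<close>-set, by choosing either one
  first.\<close>

lemma choose_ratio:
  fixes n t k :: nat
  assumes "t \<le> n" "k \<le> n"
  shows "real ((n - t) choose k) / real (n choose k) = real ((n - k) choose t) / real (n choose t)"
proof (cases "k \<le> n - t")
  case True
  have "(n choose t) * ((n - t) choose k) = (n choose k) * ((n - k) choose t)"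
    using choose_mult[of t "t + k" n] choose_mult[of k "t + k" n] True assms
    using binomial_symmetric[of t "t + k"] by simp
  then have "real (n choose t) * real ((n - t) choose k) = real (n choose k) * real ((n - k) choose t)"
    by (metis of_nat_mult)
  then show ?thesis using assms by (simp add: frac_eq_eq mult.commute)
next
  case False
  then have "n - k < t" using assms by linarith
  then show ?thesis using False by (simp add: binomial_eq_0)
qed

text \<open>In this form every summand is visibly convex and decreasing in \<open>s\<close>.\<close>

lemma corner_load_conv_sum:
  assumes "1 \<le> \<gamma>" "\<gamma> \<le> K" "1 \<le> s" "s \<le> K"
  shows "corner_load K \<gamma> s = (\<Sum>k<K - \<gamma>. real ((K - s) choose Suc k) / real ((K - 1) choose Suc k))"
proof -
  obtain t where t: "s = Suc t" using assms by (cases s) auto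
  \<comment> \<open>Pascal's rule, telescoped; the upper index of the summand runs from
    \<open>K - 2\<close> down to \<open>\<gamma> - 1\<close>.\<close>
  have hockey: "real ((K - 1) choose Suc t) - real ((\<gamma> - 1) choose Suc t)
      = (\<Sum>k<m. real ((K - 2 - k) choose t))" if "m = K - \<gamma>" for m
    using that assms(1,2)
  proof (induction m arbitrary: \<gamma>)
    case 0
    then show ?case by simp
  next
    case (Suc m)
    have "real ((K - 1) choose Suc t) - real ((Suc \<gamma> - 1) choose Suc t)
        = (\<Sum>k<m. real ((K - 2 - k) choose t))"
      using Suc by (intro Suc.IH) auto
    moreover have "(Suc \<gamma> - 1) choose Suc t = ((\<gamma> - 1) choose t) + ((\<gamma> - 1) choose Suc t)"
      using Suc.prems by (cases \<gamma>) auto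
    moreover have "K - 2 - m = \<gamma> - 1" using Suc.prems by auto
    ultimately show ?case by simp
  qed
  have "corner_load K \<gamma> s = (\<Sum>k<K - \<gamma>. real ((K - 1 - Suc k) choose t) / real ((K - 1) choose t))"
    unfolding corner_load_def t using hockey[OF refl]
    by (simp add: sum_divide_distrib[symmetric] diff_diff_eq numeral_2_eq_2)
  also have "\<dots> = (\<Sum>k<K - \<gamma>. real ((K - 1 - t) choose Suc k) / real ((K - 1) choose Suc k))"
    by (intro sum.cong refl choose_ratio[symmetric]) (use assms t in auto)
  finally show ?thesis using t by simp
qed

lemma corner_load_nonneg:
  assumes "1 \<le> \<gamma>" "\<gamma> \<le> K" "1 \<le> s" "s \<le> K"
  shows "corner_load K \<gamma> s \<ge> 0"
  unfolding corner_load_conv_sum[OF assms] by (intro sum_nonneg) auto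

lemma corner_load_full [simp]:
  assumes "1 \<le> \<gamma>" "\<gamma> \<le> K"
  shows "corner_load K \<gamma> K = 0"
  using assms by (simp add: corner_load_def binomial_eq_0)

text \<open>The increments \<open>v choose k\<close> of \<open>v choose Suc k\<close> are
  nondecreasing, so the line through the points at \<open>u - 1\<close> and \<open>u\<close>
  supports the sequence from below.\<close>

lemma choose_tangent:
  assumes "u > 0"
  shows "real (v choose Suc k) \<ge> real (u choose Suc k) + (real v - real u) * real ((u - 1) choose k)"
proof -
  obtain w where w: "u = Suc w" using assms by (cases u) auto
  have up: "real ((w + m) choose Suc k) \<ge> real (w choose Suc k) + real m * real (w choose k)" for m
  proof (induction m)
    case (Suc m)
    have "real (w choose k) \<le> real ((w + m) choose k)" by (simp add: binomial_right_mono)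
    then show ?case using Suc by (simp add: algebra_simps)
  qed simp
  have down: "m \<le> w \<Longrightarrow> real ((w - m) choose Suc k) \<ge> real (w choose Suc k) - real m * real (w choose k)" for m
  proof (induction m)
    case (Suc m)
    have "real ((w - Suc m) choose k) \<le> real (w choose k)" by (simp add: binomial_right_mono)
    moreover have "w - m = Suc (w - Suc m)" using Suc by simp
    then have "(w - m) choose Suc k = ((w - Suc m) choose k) + ((w - Suc m) choose Suc k)" by simp
    ultimately show ?case using Suc by (simp add: algebra_simps)
  qed simp
  show ?thesis
  proof (cases "w \<le> v")
    case True
    then show ?thesis using up[of "v - w"] w by (simp add: algebra_simps)
  next
    case False
    then show ?thesis using down[of "w - v"] w by (simp add: algebra_simps of_nat_diff)
  qed
qed

text \<open>Adding up the supporting lines of the summands at \<open>K - s\<close> gives a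
  supporting line of the load. Its slope in \<open>r\<close> is nonpositive, so that an upper bound
  on the mean of \<open>r\<close> suffices later.\<close>

lemma corner_load_tangent:
  assumes "1 \<le> \<gamma>" "\<gamma> \<le> K" "1 \<le> s" "s < K"
  obtains c where "c \<ge> 0"
    "\<And>r. 1 \<le> r \<Longrightarrow> r \<le> K \<Longrightarrow> corner_load K \<gamma> r \<ge> corner_load K \<gamma> s + c * (real s - real r)"
proof
  define c where "c = (\<Sum>k<K - \<gamma>. real ((K - s - 1) choose k) / real ((K - 1) choose Suc k))"
  show "c \<ge> 0" unfolding c_def by (intro sum_nonneg) auto
  fix r assume r: "1 \<le> r" "r \<le> K"
  have "corner_load K \<gamma> s + c * (real s - real r)
     = (\<Sum>k<K - \<gamma>. (real ((K - s) choose Suc k) + (real s - real r) * real ((K - s - 1) choose k))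
          / real ((K - 1) choose Suc k))"
    using assms by (subst corner_load_conv_sum)
      (auto simp: c_def sum_distrib_left sum.distrib[symmetric] add_divide_distrib mult.commute)
  also have "\<dots> \<le> (\<Sum>k<K - \<gamma>. real ((K - r) choose Suc k) / real ((K - 1) choose Suc k))"
  proof (intro sum_mono divide_right_mono)
    fix k
    show "real ((K - s) choose Suc k) + (real s - real r) * real ((K - s - 1) choose k)
        \<le> real ((K - r) choose Suc k)"
      using choose_tangent[of "K - s" k "K - r"] assms r by (simp add: of_nat_diff)
  qed simp
  also have "\<dots> = corner_load K \<gamma> r" using assms r by (subst corner_load_conv_sum) auto
  finally show "corner_load K \<gamma> r \<ge> corner_load K \<gamma> s + c * (real s - real r)" .
qed

lemma corner_load_le:
  shows "corner_load K \<gamma> s \<le> real ((K - 1) choose s) / real ((K - 1) choose (s - 1))"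
  unfolding corner_load_def by (intro divide_right_mono) auto

lemma corner_load_eq_max:
  assumes "1 \<le> K" "1 \<le> s" "\<gamma> - 1 < s"
  shows "corner_load K \<gamma> s = real ((K - 1) choose s) / real ((K - 1) choose (s - 1))"
    and "corner_load K \<gamma> s = Max ((\<lambda>\<gamma>'. corner_load K \<gamma>' s) ` {1..K})"
proof -
  show eq: "corner_load K \<gamma> s = real ((K - 1) choose s) / real ((K - 1) choose (s - 1))"
    using assms by (simp add: corner_load_def)
  have "corner_load K 1 s = corner_load K \<gamma> s"
    unfolding eq using assms by (simp add: corner_load_def)
  then show "corner_load K \<gamma> s = Max ((\<lambda>\<gamma>'. corner_load K \<gamma>' s) ` {1..K})"
    using assms corner_load_le[of K _ s] eq
    by (intro Max_eqI[symmetric]) (auto intro!: image_eqI[of _ _ 1])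
qed

section \<open>The placement and its delivery\<close>

lemma sum_Pow_card:
  fixes f :: "nat \<Rightarrow> nat"
  assumes A: "finite A" and N: "card A \<le> N"
  shows "(\<Sum>T\<in>Pow A. f (card T)) = (\<Sum>s\<le>N. (card A choose s) * f s)"
proof -
  have "(\<Sum>T\<in>Pow A. f (card T)) = (\<Sum>s\<le>N. \<Sum>T | T \<in> Pow A \<and> card T = s. f (card T))"
    by (rule sum.group[symmetric]) (use A N in \<open>auto intro: order_trans[OF card_mono]\<close>)
  also have "\<dots> = (\<Sum>s\<le>N. (card A choose s) * f s)"
    using n_subsets[OF A] by (simp cong: conj_cong)
  finally show ?thesis .
qed

lemma sum_Pow_card_containing:
  fixes f :: "nat \<Rightarrow> nat"
  assumes V: "finite V" and i: "i \<in> V"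
  shows "(\<Sum>T\<in>{T. T \<subseteq> V \<and> i \<in> T}. f (card T)) = (\<Sum>s = 1..card V. ((card V - 1) choose (s - 1)) * f s)"
proof -
  have fin: "finite T" if "T \<subseteq> V" for T using that V finite_subset by auto
  have "(\<Sum>T\<in>{T. T \<subseteq> V \<and> i \<in> T}. f (card T)) = (\<Sum>T\<in>Pow (V - {i}). f (Suc (card T)))"
  proof (rule sum.reindex_bij_witness[of _ "insert i" "\<lambda>T. T - {i}"])
    fix T assume "T \<in> {T. T \<subseteq> V \<and> i \<in> T}"
    then show "f (Suc (card (T - {i}))) = f (card T)"
      using fin[of T] card_Suc_Diff1[of T i] by auto
  qed (use i in auto)
  also have "\<dots> = (\<Sum>s\<le>card V - 1. ((card V - 1) choose s) * f (Suc s))"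
    using sum_Pow_card[of "V - {i}" "card V - 1" "\<lambda>s. f (Suc s)"] V i by simp
  also have "\<dots> = (\<Sum>s = 1..card V. ((card V - 1) choose (s - 1)) * f s)"
  proof -
    have "card V > 0" using V i card_gt_0_iff by blast
    then have "{1..card V} = Suc ` {..card V - 1}" by (auto simp: image_iff Suc_le_eq gr0_conv_Suc intro: Suc_pred)
    then show ?thesis by (simp add: sum.reindex)
  qed
  finally show ?thesis .
qed

text \<open>Each set \<open>T\<close> gets \<open>n (card T)\<close> numbered copies. The same
  indexing serves for the bits of a file and for the bits of the message.\<close>

definition slots :: "(nat \<Rightarrow> nat) \<Rightarrow> 'a set set \<Rightarrow> ('a set \<times> nat) set" where
  "slots n \<T> = (SIGMA T:\<T>. {..<n (card T)})"

lemma card_slots: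
  assumes "finite \<T>"
  shows "card (slots n \<T>) = (\<Sum>T\<in>\<T>. n (card T))"
  unfolding slots_def using assms by (simp add: card_SigmaI)

text \<open>A file has \<open>n s\<close> bits for each set \<open>T\<close> of \<open>s\<close> workers that contains its own worker;
  they are cached by the workers in \<open>T\<close>.\<close>

locale subset_placement =
  fixes K :: nat and n :: "nat \<Rightarrow> nat"
begin

definition labels :: "nat \<Rightarrow> (nat set \<times> nat) set" where
  "labels i = slots n {T. T \<subseteq> {1..K} \<and> i \<in> T}"

definition B :: nat where
  "B = (\<Sum>s = 1..K. ((K - 1) choose (s - 1)) * n s)"

definition pos :: "nat \<Rightarrow> nat set \<times> nat \<Rightarrow> nat" where
  "pos i = (SOME f. bij_betw f (labels i) {..<B})"

definition P :: placement where
  "P i j = pos i ` {l \<in> labels i. j \<in> fst l}"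

lemma finite_labels: "finite (labels i)"
  by (auto simp: labels_def slots_def)

lemma card_labels:
  assumes "i \<in> {1..K}"
  shows "card (labels i) = B"
  using sum_Pow_card_containing[of "{1..K}" i n] assms
  by (simp add: labels_def card_slots B_def)

lemma pos_bij:
  assumes "i \<in> {1..K}"
  shows "bij_betw (pos i) (labels i) {..<B}"
proof -
  have "\<exists>f. bij_betw f (labels i) {..<B}"
    by (rule finite_same_card_bij) (simp_all add: finite_labels card_labels[OF assms])
  then show ?thesis unfolding pos_def by (rule someI_ex)
qed

text \<open>For each set \<open>T\<close> containing \<open>j\<close> and each owner
  \<open>i\<close> in \<open>T - {j}\<close>, worker \<open>j\<close> stores the
  \<open>n (card T)\<close> bits of file \<open>i\<close> labelled by \<open>T\<close>; exchanging
  the two sums gives the factor \<open>s - 1\<close>.\<close>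

lemma uncoded:
  assumes S: "real (\<Sum>s = 1..K. ((K - 1) choose (s - 1)) * ((s - 1) * n s)) \<le> (S - 1) * real B"
  shows "uncoded_placement K S B P"
  unfolding uncoded_placement_def
proof (intro conjI ballI)
  fix i j assume "i \<in> {1..K} - {j}"
  then show "P i j \<subseteq> {..<B}" using pos_bij[of i] by (auto simp: P_def bij_betw_def)
next
  fix j assume j: "j \<in> {1..K}"
  let ?X = "{T. T \<subseteq> {1..K} \<and> j \<in> T}"
  have "(\<Sum>i\<in>{1..K} - {j}. card (P i j)) = (\<Sum>i\<in>{1..K} - {j}. \<Sum>T | T \<in> ?X \<and> i \<in> T. n (card T))"
  proof (rule sum.cong[OF refl])
    fix i assume i: "i \<in> {1..K} - {j}"
    have "inj_on (pos i) {l \<in> labels i. j \<in> fst l}"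
      by (rule inj_on_subset[OF bij_betw_imp_inj_on[OF pos_bij]]) (use i in auto)
    then have "card (P i j) = card {l \<in> labels i. j \<in> fst l}"
      unfolding P_def by (rule card_image)
    also have "{l \<in> labels i. j \<in> fst l} = slots n {T. T \<in> ?X \<and> i \<in> T}"
      by (auto simp: labels_def slots_def)
    finally show "card (P i j) = (\<Sum>T | T \<in> ?X \<and> i \<in> T. n (card T))"
      by (simp add: card_slots)
  qed
  also have "\<dots> = (\<Sum>T\<in>?X. \<Sum>i | i \<in> {1..K} - {j} \<and> i \<in> T. n (card T))"
    by (rule sum.swap_restrict) auto
  also have "\<dots> = (\<Sum>T\<in>?X. (card T - 1) * n (card T))"
  proof (rule sum.cong[OF refl])
    fix T assume T: "T \<in> ?X"
    then have "{i. i \<in> {1..K} - {j} \<and> i \<in> T} = T - {j}" by auto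
    then have "(\<Sum>i | i \<in> {1..K} - {j} \<and> i \<in> T. n (card T)) = card (T - {j}) * n (card T)"
      by (simp only: sum_constant of_nat_id)
    also have "card (T - {j}) = card T - 1"
      using T finite_subset[of T "{1..K}"] by (intro card_Diff_singleton) auto
    finally show "(\<Sum>i | i \<in> {1..K} - {j} \<and> i \<in> T. n (card T)) = (card T - 1) * n (card T)" .
  qed
  also have "\<dots> = (\<Sum>s = 1..K. ((K - 1) choose (s - 1)) * ((s - 1) * n s))"
    using sum_Pow_card_containing[of "{1..K}" j "\<lambda>s. (s - 1) * n s"] j by simp
  finally show "real (\<Sum>i\<in>{1..K} - {j}. card (P i j)) \<le> (S - 1) * real B" using S by simp
qed

text \<open>Copy \<open>c\<close> of all parts forms one instance of the coding problem; bits are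
  read as field elements to make it linear.\<close>

definition symbol :: "(nat \<Rightarrow> bool list) \<Rightarrow> nat \<Rightarrow> nat \<Rightarrow> nat set \<Rightarrow> bit" where
  "symbol F c x W = of_bool (F x ! pos x (W, c))"

text \<open>Per copy, the messages sent are those of the sets that avoid \<open>r\<close> and are
  not inside \<open>R - {r}\<close>, exactly the ones from which \<open>coded_msg_decode\<close>
  recovers a requested part.\<close>

lemma ex_coded_delivery:
  assumes d: "d permutes {1..K}" and R: "R \<subseteq> {1..K}" "inj_on (orbit d) R" "r \<in> R"
  shows "\<exists>X. is_delivery K B P d (card (slots n (Pow ({1..K} - {r}) - Pow (R - {r})))) X"
proof -
  let ?I = "slots n (Pow ({1..K} - {r}) - Pow (R - {r}))"
  have "finite ?I" by (auto simp: slots_def)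
  then obtain xs where xs: "set xs = ?I" "distinct xs" using finite_distinct_list by blast
  define X where "X F = map (\<lambda>(T, c). coded_msg {1..K} d (symbol F c) T = 1) xs" for F
  have "is_delivery K B P d (card ?I) X"
    unfolding is_delivery_def
  proof (intro conjI ballI ex_decoder)
    fix F show "length (X F) = card ?I" using distinct_card[OF xs(2)] xs(1) by (simp add: X_def)
  next
    fix l F F'
    assume l: "l \<in> {1..K}" and F: "F \<in> file_tuples K B" and F': "F' \<in> file_tuples K B"
      and X: "X F = X F'" and cache: "cache K P l F = cache K P l F'"
    have dl: "d l \<in> {1..K}" using l permutes_in_image[OF d] by blast
    have own: "F l = F' l" using cache by (simp add: cache_def)
    have stored: "F x ! b = F' x ! b" if "x \<in> {1..K} - {l}" "b \<in> P x l" for x b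
    proof -
      have "(\<lambda>i b. if i \<in> {1..K} - {l} \<and> b \<in> P i l then Some (F i ! b) else None)
          = (\<lambda>i b. if i \<in> {1..K} - {l} \<and> b \<in> P i l then Some (F' i ! b) else None)"
        using cache unfolding cache_def by (simp only: prod.inject)
      from fun_cong[OF fun_cong[OF this, of x], of b] that show ?thesis by (simp only: if_True simp_thms option.inject)
    qed
    show "F (d l) = F' (d l)"
    proof (rule nth_equalityI)
      show "length (F (d l)) = length (F' (d l))"
        using file_tuplesD[OF F dl] file_tuplesD[OF F' dl] by simp
      fix b assume "b < length (F (d l))"
      then have "b \<in> {..<B}" using file_tuplesD[OF F dl] by simp
      then have "b \<in> pos (d l) ` labels (d l)" using bij_betw_imp_surj_on[OF pos_bij[OF dl]] by simp
      then obtain W c where W: "(W, c) \<in> labels (d l)" and b: "b = pos (d l) (W, c)" by auto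
      have WV: "W \<subseteq> {1..K}" "d l \<in> W" and c: "c < n (card W)"
        using W by (auto simp: labels_def slots_def)
      \<comment> \<open>For two tuples with equal message and equal cache at \<open>l\<close>, the
        sum of their symbols has vanishing messages and vanishing known parts, so the kernel
        statement applies to it.\<close>
      have "symbol F c (d l) W + symbol F' c (d l) W = 0"
      proof (rule coded_msg_decode[OF _ d R, where g = "\<lambda>x W. symbol F c x W + symbol F' c x W"])
        fix T assume T: "T \<subseteq> {1..K} - {r}" "card T = card W" "\<not> T \<subseteq> R - {r}"
        then have "(T, c) \<in> set xs" using c by (auto simp: xs(1) slots_def)
        then have "(coded_msg {1..K} d (symbol F c) T = 1) = (coded_msg {1..K} d (symbol F' c) T = 1)"
          using X by (auto simp: X_def)
        then have "coded_msg {1..K} d (symbol F c) T = coded_msg {1..K} d (symbol F' c) T"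
          by (metis bit_not_one_iff)
        then show "coded_msg {1..K} d (\<lambda>x W. symbol F c x W + symbol F' c x W) T = 0"
          by (simp only: coded_msg_add bit_add_self)
      next
        fix x W' assume x: "W' \<subseteq> {1..K}" "x \<in> W'" "l \<in> W'" "card W' = card W"
        have "F x ! pos x (W', c) = F' x ! pos x (W', c)"
        proof (cases "x = l")
          case False
          have "(W', c) \<in> labels x" using x c by (auto simp: labels_def slots_def)
          then have "pos x (W', c) \<in> P x l" unfolding P_def using x by force
          then show ?thesis using stored[of x] x False by blast
        qed (simp add: own)
        then have "symbol F c x W' = symbol F' c x W'" by (simp only: symbol_def)
        then show "symbol F c x W' + symbol F' c x W' = 0" by (simp only: bit_add_self)
      qed (use l WV in auto)
      then show "F (d l) ! b = F' (d l) ! b"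
        by (cases "F (d l) ! b"; cases "F' (d l) ! b") (simp_all add: symbol_def b)
    qed
  qed
  then show ?thesis by blast
qed

text \<open>With \<gamma> cycles, of the \<open>(K - 1) choose s\<close> sets of size
  \<open>s\<close> avoiding \<open>r\<close>, the \<open>(\<gamma> - 1) choose s\<close> inside
  \<open>R - {r}\<close> are skipped.\<close>

lemma min_load_upper:
  assumes d: "d permutes {1..K}" and K: "K \<ge> 1"
  shows "min_load K B P d \<le>
    (\<Sum>s = 1..K. real (n s) * (real ((K - 1) choose s) - real ((card (orbit d ` {1..K}) - 1) choose s)))
      / real B"
proof -
  let ?\<gamma> = "card (orbit d ` {1..K})"
  obtain R where R: "R \<subseteq> {1..K}" "inj_on (orbit d) R" "orbit d ` R = orbit d ` {1..K}" "card R = ?\<gamma>"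
    by (rule orbit_representatives)
  then obtain r where r: "r \<in> R" using K by fastforce
  have finR: "finite R" using finite_subset[OF R(1)] by simp
  have cR: "card (R - {r}) = ?\<gamma> - 1" "card ({1..K} - {r}) = K - 1"
    using R r finR by (auto simp: card_Diff_singleton)
  have cRK: "card (R - {r}) \<le> K" using card_mono[OF _ R(1)] cR R by simp
  obtain X where "is_delivery K B P d (card (slots n (Pow ({1..K} - {r}) - Pow (R - {r})))) X"
    using ex_coded_delivery[OF d R(1,2) r] by blast
  moreover have "real (card (slots n (Pow ({1..K} - {r}) - Pow (R - {r}))))
    = (\<Sum>s = 1..K. real (n s) * (real ((K - 1) choose s) - real ((?\<gamma> - 1) choose s)))"
  proof -
    have sub: "Pow (R - {r}) \<subseteq> Pow ({1..K} - {r})" using R by auto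
    have "(\<Sum>T\<in>Pow ({1..K} - {r}). n (card T))
        = (\<Sum>T\<in>Pow ({1..K} - {r}) - Pow (R - {r}). n (card T)) + (\<Sum>T\<in>Pow (R - {r}). n (card T))"
      by (rule sum.subset_diff[OF sub]) auto
    then have split: "(\<Sum>s\<le>K. ((K - 1) choose s) * n s)
        = card (slots n (Pow ({1..K} - {r}) - Pow (R - {r}))) + (\<Sum>s\<le>K. ((?\<gamma> - 1) choose s) * n s)"
      using sum_Pow_card[of "{1..K} - {r}" K n] sum_Pow_card[of "R - {r}" K n] cR cRK finR
      by (simp add: card_slots)
    have "real (card (slots n (Pow ({1..K} - {r}) - Pow (R - {r}))))
        = real (\<Sum>s\<le>K. ((K - 1) choose s) * n s) - real (\<Sum>s\<le>K. ((?\<gamma> - 1) choose s) * n s)"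
      by (simp only: split of_nat_add add_diff_cancel_right')
    also have "\<dots> = (\<Sum>s\<le>K. real (n s) * (real ((K - 1) choose s) - real ((?\<gamma> - 1) choose s)))"
      by (simp add: sum_subtractf[symmetric] algebra_simps)
    \<comment> \<open>The empty set is counted in both binomials, so the term for
      \<open>s = 0\<close> vanishes.\<close>
    also have "\<dots> = (\<Sum>s = 1..K. real (n s) * (real ((K - 1) choose s) - real ((?\<gamma> - 1) choose s)))"
      by (rule sum.mono_neutral_right) (auto simp: Suc_le_eq)
    finally show ?thesis .
  qed
  ultimately show ?thesis using min_load_le by metis
qed

end

section \<open>Averaging over the assignments\<close>

text \<open>Only excess copies are counted; the successor of this number is the number of workers
  that know the bit and corresponds to the parameter \<open>s\<close>.\<close>

definition caching_multiplicity :: "nat \<Rightarrow> placement \<Rightarrow> nat \<Rightarrow> nat \<Rightarrow> nat" where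
  "caching_multiplicity K P i b = card {j \<in> {1..K} - {i}. b \<in> P i j}"

lemma caching_multiplicity_less:
  assumes "i \<in> {1..K}"
  shows "Suc (caching_multiplicity K P i b) \<le> K"
proof -
  have "caching_multiplicity K P i b \<le> card ({1..K} - {i})"
    unfolding caching_multiplicity_def by (intro card_mono) auto
  moreover have "card ({1..K} - {i}) = K - 1" "K \<ge> 1" using assms by auto
  ultimately show ?thesis by linarith
qed

text \<open>Counting stored bits by position instead of by worker turns the storage constraints into
  a bound of \<open>S - 1\<close> on the mean multiplicity.\<close>

lemma sum_caching_multiplicity_le:
  assumes P: "uncoded_placement K S B P"
  shows "(\<Sum>i\<in>{1..K}. \<Sum>b<B. real (caching_multiplicity K P i b)) \<le> real K * ((S - 1) * real B)"
proof -
  have "(\<Sum>b<B. caching_multiplicity K P i b) = (\<Sum>j\<in>{1..K} - {i}. card (P i j))" if i: "i \<in> {1..K}" for i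
  proof -
    have sub: "P i j \<subseteq> {..<B}" if "j \<in> {1..K} - {i}" for j
      using P i that unfolding uncoded_placement_def by blast
    have "(\<Sum>b<B. caching_multiplicity K P i b) = (\<Sum>b<B. \<Sum>j | j \<in> {1..K} - {i} \<and> b \<in> P i j. 1)"
      by (simp add: caching_multiplicity_def)
    also have "\<dots> = (\<Sum>j\<in>{1..K} - {i}. \<Sum>b | b \<in> {..<B} \<and> b \<in> P i j. 1)"
      by (rule sum.swap_restrict) auto
    also have "\<dots> = (\<Sum>j\<in>{1..K} - {i}. card (P i j))"
    proof (rule sum.cong[OF refl])
      fix j assume "j \<in> {1..K} - {i}"
      then have "{b. b \<in> {..<B} \<and> b \<in> P i j} = P i j" using sub by blast
      then show "(\<Sum>b | b \<in> {..<B} \<and> b \<in> P i j. 1) = card (P i j)" by simp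
    qed
    finally show ?thesis .
  qed
  moreover have "{1..K} - {i} = {j. j \<in> {1..K} \<and> i \<noteq> j}" for i by auto
  ultimately have "(\<Sum>i\<in>{1..K}. \<Sum>b<B. caching_multiplicity K P i b)
      = (\<Sum>i\<in>{1..K}. \<Sum>j | j \<in> {1..K} \<and> i \<noteq> j. card (P i j))"
    by (intro sum.cong[where A = "{1..K}", OF refl]) (simp only:)
  also have "\<dots> = (\<Sum>j\<in>{1..K}. \<Sum>i | i \<in> {1..K} \<and> i \<noteq> j. card (P i j))"
    by (rule sum.swap_restrict) auto
  also have "\<dots> = (\<Sum>j\<in>{1..K}. \<Sum>i\<in>{1..K} - {j}. card (P i j))"
    by (intro sum.cong refl) auto
  finally have eq: "(\<Sum>i\<in>{1..K}. \<Sum>b<B. caching_multiplicity K P i b)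
      = (\<Sum>j\<in>{1..K}. \<Sum>i\<in>{1..K} - {j}. card (P i j))" .
  have "(\<Sum>i\<in>{1..K}. \<Sum>b<B. real (caching_multiplicity K P i b))
      = real (\<Sum>i\<in>{1..K}. \<Sum>b<B. caching_multiplicity K P i b)"
    by simp
  also have "\<dots> = (\<Sum>j\<in>{1..K}. real (\<Sum>i\<in>{1..K} - {j}. card (P i j)))"
    unfolding eq by simp
  also have "\<dots> \<le> (\<Sum>j\<in>{1..K}. (S - 1) * real B)"
    by (intro sum_mono) (use P in \<open>unfold uncoded_placement_def, blast\<close>)
  also have "\<dots> = real K * ((S - 1) * real B)" by simp
  finally show ?thesis .
qed

text \<open>For each \<open>i\<close>, a fraction \<open>1 / K\<close> of the permutations sends
  \<open>v\<close> to \<open>i\<close>. Among these the image of \<open>A\<close> is uniformly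
  distributed over the subsets of its size of the other workers, and the quotient of binomials is
  the probability that it avoids all excess copies of bit \<open>b\<close>.\<close>

lemma sum_permutations_avoiding:
  assumes v: "v \<in> {1..K}" "A \<subseteq> {1..K} - {v}"
  shows "(\<Sum>\<pi> | \<pi> permutes {1..K}. real (card {b\<in>{..<B}. \<forall>a\<in>A. b \<notin> P (\<pi> v) (\<pi> a)}))
    = (\<Sum>i\<in>{1..K}. \<Sum>b<B. fact K / real K *
        (real ((K - Suc (caching_multiplicity K P i b)) choose card A) / real ((K - 1) choose card A)))"
proof -
  let ?V = "{1..K}"
  define C where "C i b = {j \<in> ?V - {i}. b \<in> P i j}" for i b
  have finP: "finite {\<pi>. \<pi> permutes ?V}" by (simp add: finite_permutations)
  have avoid: "(\<forall>a\<in>A. b \<notin> P (\<pi> v) (\<pi> a)) \<longleftrightarrow> \<pi> ` A \<inter> C (\<pi> v) b = {}" if \<pi>: "\<pi> permutes ?V" for \<pi> b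
  proof -
    have "\<pi> a \<in> ?V - {\<pi> v}" if "a \<in> A" for a
      using that v permutes_in_image[OF \<pi>] permutes_inj[OF \<pi>] by (auto dest: injD)
    then show ?thesis by (auto simp: C_def)
  qed
  have "(\<Sum>\<pi> | \<pi> permutes ?V. card {b\<in>{..<B}. \<forall>a\<in>A. b \<notin> P (\<pi> v) (\<pi> a)})
      = (\<Sum>\<pi> | \<pi> permutes ?V. \<Sum>b | b \<in> {..<B} \<and> \<pi> ` A \<inter> C (\<pi> v) b = {}. 1)"
    by (intro sum.cong refl) (simp add: avoid)
  also have "\<dots> = (\<Sum>b<B. \<Sum>\<pi> | \<pi> \<in> {\<pi>. \<pi> permutes ?V} \<and> \<pi> ` A \<inter> C (\<pi> v) b = {}. 1)"
    by (rule sum.swap_restrict[OF finP]) simp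
  also have "\<dots> = (\<Sum>b<B. \<Sum>i\<in>?V. card {\<pi>. \<pi> permutes ?V \<and> \<pi> v = i \<and> \<pi> ` A \<inter> C i b = {}})"
  proof (rule sum.cong[OF refl])
    fix b
    let ?Q = "{\<pi>. \<pi> \<in> {\<pi>. \<pi> permutes ?V} \<and> \<pi> ` A \<inter> C (\<pi> v) b = {}}"
    have "(\<Sum>i\<in>?V. \<Sum>\<pi> | \<pi> \<in> ?Q \<and> \<pi> v = i. 1) = (\<Sum>\<pi>\<in>?Q. 1::nat)"
    proof (rule sum.group)
      show "(\<lambda>\<pi>. \<pi> v) ` ?Q \<subseteq> ?V" using v(1) permutes_in_image by fastforce
    qed (use finP in auto)
    moreover have "{\<pi>. \<pi> \<in> ?Q \<and> \<pi> v = i} = {\<pi>. \<pi> permutes ?V \<and> \<pi> v = i \<and> \<pi> ` A \<inter> C i b = {}}" for i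
      by auto
    ultimately show "(\<Sum>\<pi>\<in>?Q. 1) = (\<Sum>i\<in>?V. card {\<pi>. \<pi> permutes ?V \<and> \<pi> v = i \<and> \<pi> ` A \<inter> C i b = {}})"
      by (simp only: card_eq_sum)
  qed
  also have "\<dots> = (\<Sum>i\<in>?V. \<Sum>b<B. card {\<pi>. \<pi> permutes ?V \<and> \<pi> v = i \<and> \<pi> ` A \<inter> C i b = {}})"
    by (rule sum.swap)
  finally have "(\<Sum>\<pi> | \<pi> permutes ?V. real (card {b\<in>{..<B}. \<forall>a\<in>A. b \<notin> P (\<pi> v) (\<pi> a)}))
      = (\<Sum>i\<in>?V. \<Sum>b<B. real (card {\<pi>. \<pi> permutes ?V \<and> \<pi> v = i \<and> \<pi> ` A \<inter> C i b = {}}))"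
    by (simp only: of_nat_sum[symmetric])
  also have "\<dots> = (\<Sum>i\<in>?V. \<Sum>b<B. fact K / real K *
        (real ((K - Suc (caching_multiplicity K P i b)) choose card A) / real ((K - 1) choose card A)))"
  proof (intro sum.cong refl)
    fix i b assume i: "i \<in> ?V"
    let ?c = "card {\<pi>. \<pi> permutes ?V \<and> \<pi> v = i \<and> \<pi> ` A \<inter> C i b = {}}"
    have "C i b \<subseteq> ?V - {i}" by (auto simp: C_def)
    from card_permutations_avoiding[OF _ v i this]
    have "?c * (K * ((K - 1) choose card A)) = fact K * ((K - 1 - card (C i b)) choose card A)"
      by simp
    moreover have "K - 1 - card (C i b) = K - Suc (caching_multiplicity K P i b)"
      by (simp add: caching_multiplicity_def C_def)
    ultimately have "real (?c * (K * ((K - 1) choose card A)))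
        = real (fact K * ((K - Suc (caching_multiplicity K P i b)) choose card A))"
      by (simp only:)
    then have eq: "real ?c * (real K * real ((K - 1) choose card A))
        = fact K * real ((K - Suc (caching_multiplicity K P i b)) choose card A)"
      by (simp only: of_nat_mult of_nat_fact)
    have "card A \<le> K - 1" using card_mono[OF _ v(2)] v(1) by simp
    then have "real ((K - 1) choose card A) > 0" by simp
    moreover have "real K > 0" using i by simp
    ultimately show "real ?c = fact K / real K *
        (real ((K - Suc (caching_multiplicity K P i b)) choose card A) / real ((K - 1) choose card A))"
      using eq by (simp add: field_simps)
  qed
  finally show ?thesis .
qed

text \<open>The path order of \<open>d\<close> is carried by \<open>\<pi>\<close> to one for the
  conjugate, so a single choice of \<open>us\<close> bounds all summands. After averaging, the bound
  depends on the placement only through the multiplicities.\<close>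

lemma sum_conj_min_load_ge:
  assumes d: "d permutes {1..K}" and P: "uncoded_placement K S B P" and B: "B > 0" and K: "K \<ge> 1"
    and \<gamma>: "\<gamma> = card (orbit d ` {1..K})"
  shows "(\<Sum>\<pi> | \<pi> permutes {1..K}. min_load K B P (\<pi> \<circ> d \<circ> inv \<pi>)) / fact K
    \<ge> (\<Sum>i\<in>{1..K}. \<Sum>b<B. corner_load K \<gamma> (Suc (caching_multiplicity K P i b))) / (real K * real B)"
proof -
  let ?V = "{1..K}" and ?t = "caching_multiplicity K P"
  have \<gamma>_bounds: "1 \<le> \<gamma>" "\<gamma> \<le> K"
    using \<gamma> K card_image_le[of ?V "orbit d"] by (auto simp: Suc_le_eq card_gt_0_iff)
  obtain us where us: "distinct us" "set us \<subseteq> ?V" "length us = K - \<gamma>"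
    and ord: "\<And>j k. k < length us \<Longrightarrow> j \<le> k \<Longrightarrow> d (us ! k) \<noteq> us ! j"
    using acyclic_order[OF d] \<gamma> by auto
  \<comment> \<open>The workers visited up to and including step \<open>k\<close>, since the one at
    step \<open>k\<close> decodes with its own cache too. Hence the size \<open>Suc k\<close>, which
    matches the binomials in \<open>corner_load_conv_sum\<close>.\<close>
  define A where "A k = set (take (Suc k) us)" for k
  have A: "A k = (!) us ` {..k}" if "k < length us" for k
    using that nth_image[of "Suc k" us] by (auto simp: A_def atLeast0LessThan lessThan_Suc_atMost)
  have cardA: "card (A k) = Suc k" if "k < length us" for k
    using that us(1) by (simp add: A_def distinct_card)
  have dV: "d (us ! k) \<in> ?V" if "k < length us" for k
    using that us(2) permutes_in_image[OF d] nth_mem by blast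
  have AV: "A k \<subseteq> ?V - {d (us ! k)}" if k: "k < length us" for k
  proof -
    have "A k \<subseteq> ?V" using us(2) set_take_subset[of "Suc k" us] by (auto simp: A_def)
    moreover have "d (us ! k) \<notin> A k" using ord[OF k] A[OF k] by auto
    ultimately show ?thesis by auto
  qed
  have lower: "(\<Sum>k<K - \<gamma>. real (card {b\<in>{..<B}. \<forall>a\<in>A k. b \<notin> P (\<pi> (d (us ! k))) (\<pi> a)})) / real B
      \<le> min_load K B P (\<pi> \<circ> d \<circ> inv \<pi>)" if \<pi>: "\<pi> permutes ?V" for \<pi>
  proof -
    let ?d = "\<pi> \<circ> d \<circ> inv \<pi>"
    have d': "?d permutes ?V" by (intro permutes_compose permutes_inv \<pi> d)
    have inj\<pi>: "inj \<pi>" using permutes_inj[OF \<pi>] .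
    obtain L X where X: "is_delivery K B P ?d L X" and L: "min_load K B P ?d = real L / real B"
      using min_load_attained[OF d'] by blast
    have "(\<Sum>k<length (map \<pi> us). card {b\<in>{..<B}. \<forall>j\<le>k. b \<notin> P (?d (map \<pi> us ! k)) (map \<pi> us ! j)}) \<le> L"
    proof (rule delivery_length_ge[OF X d' P])
      show "distinct (map \<pi> us)" using us(1) inj_on_subset[OF inj\<pi>] by (simp add: distinct_map)
      show "set (map \<pi> us) \<subseteq> ?V" using us(2) permutes_in_image[OF \<pi>] by auto
      fix j k assume "k < length (map \<pi> us)" "j \<le> k"
      then show "?d (map \<pi> us ! k) \<noteq> map \<pi> us ! j"
        using ord[of k j] inj\<pi> by (simp add: permutes_inverses[OF \<pi>] inj_eq)
    qed
    moreover have "(\<Sum>k<length (map \<pi> us). card {b\<in>{..<B}. \<forall>j\<le>k. b \<notin> P (?d (map \<pi> us ! k)) (map \<pi> us ! j)})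
        = (\<Sum>k<K - \<gamma>. card {b\<in>{..<B}. \<forall>a\<in>A k. b \<notin> P (\<pi> (d (us ! k))) (\<pi> a)})"
    proof (rule sum.cong)
      fix k assume "k \<in> {..<K - \<gamma>}"
      then have k: "k < length us" using us by simp
      have "(\<forall>j\<le>k. b \<notin> P (?d (map \<pi> us ! k)) (map \<pi> us ! j))
          \<longleftrightarrow> (\<forall>a\<in>A k. b \<notin> P (\<pi> (d (us ! k))) (\<pi> a))" for b
        using k by (auto simp: A[OF k] permutes_inverses[OF \<pi>])
      then show "card {b\<in>{..<B}. \<forall>j\<le>k. b \<notin> P (?d (map \<pi> us ! k)) (map \<pi> us ! j)}
          = card {b\<in>{..<B}. \<forall>a\<in>A k. b \<notin> P (\<pi> (d (us ! k))) (\<pi> a)}" by (simp only:)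
    qed (simp add: us)
    ultimately have "(\<Sum>k<K - \<gamma>. real (card {b\<in>{..<B}. \<forall>a\<in>A k. b \<notin> P (\<pi> (d (us ! k))) (\<pi> a)})) \<le> real L"
      by (simp only: of_nat_sum[symmetric] of_nat_le_iff)
    then show ?thesis unfolding L by (rule divide_right_mono) simp
  qed
  have "(\<Sum>\<pi> | \<pi> permutes ?V. \<Sum>k<K - \<gamma>. real (card {b\<in>{..<B}. \<forall>a\<in>A k. b \<notin> P (\<pi> (d (us ! k))) (\<pi> a)}))
    = (\<Sum>k<K - \<gamma>. \<Sum>\<pi> | \<pi> permutes ?V. real (card {b\<in>{..<B}. \<forall>a\<in>A k. b \<notin> P (\<pi> (d (us ! k))) (\<pi> a)}))"
    by (rule sum.swap)
  also have "\<dots> = (\<Sum>k<K - \<gamma>. \<Sum>i\<in>?V. \<Sum>b<B. fact K / real K *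
        (real ((K - Suc (?t i b)) choose Suc k) / real ((K - 1) choose Suc k)))"
    using sum_permutations_avoiding[OF dV AV] cardA us(3) by (intro sum.cong refl) simp
  also have "\<dots> = (\<Sum>i\<in>?V. \<Sum>b<B. \<Sum>k<K - \<gamma>. fact K / real K *
        (real ((K - Suc (?t i b)) choose Suc k) / real ((K - 1) choose Suc k)))"
    by (subst sum.swap, rule sum.cong[OF refl], rule sum.swap)
  also have "\<dots> = (\<Sum>i\<in>?V. \<Sum>b<B. fact K / real K * corner_load K \<gamma> (Suc (?t i b)))"
    by (intro sum.cong refl, subst corner_load_conv_sum)
      (use \<gamma>_bounds caching_multiplicity_less in \<open>auto simp: sum_distrib_left\<close>)
  also have "\<dots> = fact K / real K * (\<Sum>i\<in>?V. \<Sum>b<B. corner_load K \<gamma> (Suc (?t i b)))"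
    by (simp only: sum_distrib_left)
  finally have "fact K / real K * (\<Sum>i\<in>?V. \<Sum>b<B. corner_load K \<gamma> (Suc (?t i b))) / real B
    = (\<Sum>\<pi> | \<pi> permutes ?V. (\<Sum>k<K - \<gamma>. real (card {b\<in>{..<B}. \<forall>a\<in>A k. b \<notin> P (\<pi> (d (us ! k))) (\<pi> a)})) / real B)"
    by (simp only: sum_divide_distrib[symmetric])
  also have "\<dots> \<le> (\<Sum>\<pi> | \<pi> permutes ?V. min_load K B P (\<pi> \<circ> d \<circ> inv \<pi>))"
    by (intro sum_mono lower) simp
  finally have *: "fact K / real K * (\<Sum>i\<in>?V. \<Sum>b<B. corner_load K \<gamma> (Suc (?t i b))) / real B / fact K
      \<le> (\<Sum>\<pi> | \<pi> permutes ?V. min_load K B P (\<pi> \<circ> d \<circ> inv \<pi>)) / fact K"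
    by (rule divide_right_mono) simp
  have "fact K / real K * x / real B / fact K = x / (real K * real B)" for x by simp
  then show ?thesis using * by metis
qed

text \<open>An orbit-stabilizer count: every assignment with the graph of \<open>d\<close> arises by
  conjugation with the same number of \<open>\<pi>\<close>, the size of the centralizer of
  \<open>d\<close>, so both averages are uniform over the conjugacy class.\<close>

lemma average_assignments:
  fixes f :: "(nat \<Rightarrow> nat) \<Rightarrow> real"
  assumes d: "d permutes {1..K}"
  shows "(\<Sum>d'\<in>assignments_of K (transition_graph K d). f d') / real (card (assignments_of K (transition_graph K d)))
    = (\<Sum>\<pi> | \<pi> permutes {1..K}. f (\<pi> \<circ> d \<circ> inv \<pi>)) / fact K"
proof -
  let ?V = "{1..K}"
  let ?\<Pi> = "{\<pi>. \<pi> permutes ?V}" and ?\<Phi> = "\<lambda>\<pi>. \<pi> \<circ> d \<circ> inv \<pi>"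
  let ?D = "assignments_of K (transition_graph K d)"
  let ?fib = "\<lambda>d'. {\<pi>. \<pi> \<in> ?\<Pi> \<and> ?\<Phi> \<pi> = d'}"
  have D: "?D = ?\<Phi> ` ?\<Pi>" by (rule assignments_of_transition_graph[OF d])
  have fin: "finite ?\<Pi>" by (simp add: finite_permutations)
  have fib: "card (?fib d') = card (?fib d)" if d': "d' \<in> ?D" for d'
  proof -
    obtain \<sigma> where \<sigma>: "\<sigma> permutes ?V" "d' = ?\<Phi> \<sigma>" using d' unfolding D by blast
    have conj: "?\<Phi> (\<sigma> \<circ> \<pi>) = \<sigma> \<circ> ?\<Phi> \<pi> \<circ> inv \<sigma>" if "\<pi> permutes ?V" for \<pi>
      using o_inv_distrib[OF permutes_bij[OF \<sigma>(1)] permutes_bij[OF that]] by (simp add: comp_assoc)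
    have conj': "?\<Phi> (inv \<sigma> \<circ> \<pi>) = inv \<sigma> \<circ> ?\<Phi> \<pi> \<circ> \<sigma>" if "\<pi> permutes ?V" for \<pi>
      using o_inv_distrib[OF permutes_bij[OF permutes_inv[OF \<sigma>(1)]] permutes_bij[OF that]]
        permutes_inv_inv[OF \<sigma>(1)] by (simp add: comp_assoc)
    have "bij_betw (\<lambda>\<pi>. \<sigma> \<circ> \<pi>) (?fib d) (?fib d')"
    proof (rule bij_betw_byWitness[where f' = "\<lambda>\<pi>. inv \<sigma> \<circ> \<pi>"])
      show "(\<lambda>\<pi>. \<sigma> \<circ> \<pi>) ` ?fib d \<subseteq> ?fib d'"
      proof (rule image_subsetI)
        fix \<pi> assume "\<pi> \<in> ?fib d"
        then have \<pi>: "\<pi> permutes ?V" "?\<Phi> \<pi> = d" by auto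
        have "?\<Phi> (\<sigma> \<circ> \<pi>) = d'" unfolding conj[OF \<pi>(1)] \<pi>(2) \<sigma>(2) ..
        then show "\<sigma> \<circ> \<pi> \<in> ?fib d'" using permutes_compose[OF \<pi>(1) \<sigma>(1)] by blast
      qed
      show "(\<lambda>\<pi>. inv \<sigma> \<circ> \<pi>) ` ?fib d' \<subseteq> ?fib d"
      proof (rule image_subsetI)
        fix \<pi> assume "\<pi> \<in> ?fib d'"
        then have \<pi>: "\<pi> permutes ?V" "?\<Phi> \<pi> = ?\<Phi> \<sigma>" using \<sigma>(2) by auto
        have "?\<Phi> (inv \<sigma> \<circ> \<pi>) = d" unfolding conj'[OF \<pi>(1)] \<pi>(2)
          by (simp add: fun_eq_iff permutes_inverses[OF \<sigma>(1)])
        then show "inv \<sigma> \<circ> \<pi> \<in> ?fib d"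
          using permutes_compose[OF \<pi>(1) permutes_inv[OF \<sigma>(1)]] by blast
      qed
    qed (auto simp: fun_eq_iff permutes_inverses[OF \<sigma>(1)])
    then show ?thesis by (simp only: bij_betw_same_card)
  qed
  have sum: "(\<Sum>\<pi>\<in>?\<Pi>. h (?\<Phi> \<pi>)) = real (card (?fib d)) * (\<Sum>d'\<in>?D. h d')" for h :: "(nat \<Rightarrow> nat) \<Rightarrow> real"
  proof -
    have "(\<Sum>\<pi>\<in>?\<Pi>. h (?\<Phi> \<pi>)) = (\<Sum>d'\<in>?D. \<Sum>\<pi>\<in>?fib d'. h (?\<Phi> \<pi>))"
      unfolding D by (rule sum.image_gen[OF fin])
    also have "\<dots> = (\<Sum>d'\<in>?D. real (card (?fib d)) * h d')"
    proof (rule sum.cong[OF refl])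
      fix d' assume d': "d' \<in> ?D"
      have "(\<Sum>\<pi>\<in>?fib d'. h (?\<Phi> \<pi>)) = (\<Sum>\<pi>\<in>?fib d'. h d')" by (rule sum.cong) auto
      also have "\<dots> = real (card (?fib d)) * h d'" using fib[OF d'] by (simp only: sum_constant)
      finally show "(\<Sum>\<pi>\<in>?fib d'. h (?\<Phi> \<pi>)) = real (card (?fib d)) * h d'" .
    qed
    finally show ?thesis by (simp only: sum_distrib_left)
  qed
  have "fact K = real (card ?\<Pi>)" using card_permutations[of ?V K] by simp
  also have "\<dots> = real (card (?fib d)) * real (card ?D)" using sum[of "\<lambda>_. 1"] by simp
  finally have eq: "fact K = real (card (?fib d)) * real (card ?D)" .
  have "(fact K :: real) \<noteq> 0" by simp
  then have "real (card (?fib d)) \<noteq> 0" using eq by auto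
  then show ?thesis unfolding sum eq by simp
qed

section \<open>Optimal loads\<close>

lemma card_orbits_bounds:
  assumes d: "d permutes {1..K}" and K: "K \<ge> 1"
  shows "1 \<le> card (orbit d ` {1..K})" "card (orbit d ` {1..K}) \<le> K"
  using K card_image_le[of "{1..K}" "orbit d"] by (auto simp: Suc_le_eq card_gt_0_iff)

lemma assignments_of_props:
  assumes d: "d permutes {1..K}"
  shows "finite (assignments_of K (transition_graph K d))"
    and "assignments_of K (transition_graph K d) \<noteq> {}"
    and "d' \<in> assignments_of K (transition_graph K d) \<Longrightarrow> d' permutes {1..K}"
    and "d' \<in> assignments_of K (transition_graph K d) \<Longrightarrow> card (orbit d' ` {1..K}) = card (orbit d ` {1..K})"
proof -
  have D: "assignments_of K (transition_graph K d) = (\<lambda>\<pi>. \<pi> \<circ> d \<circ> inv \<pi>) ` {\<pi>. \<pi> permutes {1..K}}"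
    by (rule assignments_of_transition_graph[OF d])
  show "finite (assignments_of K (transition_graph K d))"
    unfolding D by (simp add: finite_permutations)
  show "assignments_of K (transition_graph K d) \<noteq> {}"
    unfolding D using permutes_id by blast
  show "d' permutes {1..K}" if "d' \<in> assignments_of K (transition_graph K d)"
    using that unfolding assignments_of_def by blast
  show "card (orbit d' ` {1..K}) = card (orbit d ` {1..K})"
    if "d' \<in> assignments_of K (transition_graph K d)"
    using that unfolding D using card_orbits_conj[OF d] by blast
qed

lemma average_load_ge:
  assumes d: "d permutes {1..K}" and P: "uncoded_placement K S B P" and B: "B > 0" and K: "K \<ge> 1"
    and G: "G = transition_graph K d" and \<gamma>: "\<gamma> = card (orbit d ` {1..K})"
  shows "(\<Sum>d\<in>assignments_of K G. min_load K B P d) / real (card (assignments_of K G))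
    \<ge> (\<Sum>i\<in>{1..K}. \<Sum>b<B. corner_load K \<gamma> (Suc (caching_multiplicity K P i b))) / (real K * real B)"
  unfolding G average_assignments[OF d] using sum_conj_min_load_ge[OF d P B K \<gamma>] .

text \<open>Jensen's inequality with the supporting line at \<open>s\<close>: one plus the
  multiplicity has mean at most \<open>s\<close>, and the line is nonincreasing.\<close>

lemma mean_corner_load_ge:
  assumes P: "uncoded_placement K (real s) B P" and B: "B > 0" and K: "K \<ge> 1"
    and \<gamma>: "1 \<le> \<gamma>" "\<gamma> \<le> K" and s: "1 \<le> s" "s \<le> K"
  shows "(\<Sum>i\<in>{1..K}. \<Sum>b<B. corner_load K \<gamma> (Suc (caching_multiplicity K P i b))) / (real K * real B)
    \<ge> corner_load K \<gamma> s"
proof -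
  let ?t = "caching_multiplicity K P"
  have KB: "real K * real B > 0" using K B by simp
  have t: "1 \<le> Suc (?t i b)" "Suc (?t i b) \<le> K" if "i \<in> {1..K}" for i b
    using caching_multiplicity_less[OF that] by auto
  have "real K * real B * corner_load K \<gamma> s
      \<le> (\<Sum>i\<in>{1..K}. \<Sum>b<B. corner_load K \<gamma> (Suc (?t i b)))"
  proof (cases "s = K")
    \<comment> \<open>The supporting line is available only for \<open>s < K\<close>; at
      \<open>s = K\<close> the load is zero and nonnegativity suffices.\<close>
    case True
    then show ?thesis using \<gamma> t by (auto intro!: sum_nonneg corner_load_nonneg)
  next
    case False
    then obtain c where c: "c \<ge> 0"
      "\<And>r. 1 \<le> r \<Longrightarrow> r \<le> K \<Longrightarrow> corner_load K \<gamma> r \<ge> corner_load K \<gamma> s + c * (real s - real r)"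
      using corner_load_tangent[OF \<gamma> s(1)] s(2) by (metis le_neq_implies_less)
    have "(\<Sum>i\<in>{1..K}. \<Sum>b<B. real (?t i b)) \<le> real K * real B * (real s - 1)"
      using sum_caching_multiplicity_le[OF P] by (simp add: mult_ac)
    then have "c * (\<Sum>i\<in>{1..K}. \<Sum>b<B. real (?t i b)) \<le> c * (real K * real B * (real s - 1))"
      by (rule mult_left_mono) (rule c(1))
    then have "real K * real B * corner_load K \<gamma> s
        \<le> real K * real B * (corner_load K \<gamma> s + c * (real s - 1)) - c * (\<Sum>i\<in>{1..K}. \<Sum>b<B. real (?t i b))"
      by (simp add: algebra_simps)
    also have "\<dots> = (\<Sum>i\<in>{1..K}. \<Sum>b<B. (corner_load K \<gamma> s + c * (real s - 1)) - c * real (?t i b))"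
      by (simp add: sum_subtractf sum_distrib_left)
    also have "\<dots> = (\<Sum>i\<in>{1..K}. \<Sum>b<B. corner_load K \<gamma> s + c * (real s - real (Suc (?t i b))))"
      by (simp add: algebra_simps)
    also have "\<dots> \<le> (\<Sum>i\<in>{1..K}. \<Sum>b<B. corner_load K \<gamma> (Suc (?t i b)))"
      by (intro sum_mono c(2) t)
    finally show ?thesis .
  qed
  then show ?thesis using KB by (simp add: pos_le_divide_eq mult.commute)
qed

text \<open>One bit per set of size \<open>s\<close> is enough. The placement does not depend on
  \<open>d\<close>, so it serves the averages for all graphs and the worst case at once.\<close>

lemma ex_optimal_placement:
  assumes K: "K \<ge> 1" and s: "1 \<le> s" "s \<le> K"
  obtains B P where "B > 0" "uncoded_placement K (real s) B P"
    "\<And>d. d permutes {1..K} \<Longrightarrow> min_load K B P d \<le> corner_load K (card (orbit d ` {1..K})) s"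
proof -
  define n where "n x = (if x = s then 1 else 0 :: nat)" for x
  interpret subset_placement K n .
  have B: "B = (K - 1) choose (s - 1)"
    unfolding B_def n_def using s by (simp add: if_distrib cong: if_cong)
  have "(\<Sum>x = 1..K. ((K - 1) choose (x - 1)) * ((x - 1) * n x)) = (s - 1) * B"
    unfolding B n_def using s by (simp add: if_distrib cong: if_cong)
  then have "uncoded_placement K (real s) B P"
    using s by (intro uncoded) (simp add: of_nat_diff)
  moreover have "B > 0" using s unfolding B by simp
  moreover have "min_load K B P d \<le> corner_load K (card (orbit d ` {1..K})) s" if d: "d permutes {1..K}" for d
  proof -
    have "(\<Sum>x = 1..K. real (n x) * (real ((K - 1) choose x) - real ((card (orbit d ` {1..K}) - 1) choose x)))
        = real ((K - 1) choose s) - real ((card (orbit d ` {1..K}) - 1) choose s)"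
      unfolding n_def using s by (simp add: if_distrib[of real] if_distrib[of "\<lambda>a. a * _"] cong: if_cong)
    then show ?thesis using min_load_upper[OF d K] unfolding corner_load_def B by (simp only:)
  qed
  ultimately show ?thesis using that by blast
qed

lemma opt_load_integer:
  assumes K: "K \<ge> 1" and d: "d permutes {1..K}" and G: "G = transition_graph K d"
    and \<gamma>: "\<gamma> = card (orbit d ` {1..K})" and s: "1 \<le> s" "s \<le> K"
  shows "opt_load K (real s) G = corner_load K \<gamma> s"
proof -
  let ?avg = "\<lambda>B P. (\<Sum>d\<in>assignments_of K G. min_load K B P d) / real (card (assignments_of K G))"
  have \<gamma>_bounds: "1 \<le> \<gamma>" "\<gamma> \<le> K" using card_orbits_bounds[OF d K] \<gamma> by auto
  have ge: "corner_load K \<gamma> s \<le> ?avg B P" if "B > 0" "uncoded_placement K (real s) B P" for B P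
    using order_trans[OF mean_corner_load_ge[OF that(2,1) K \<gamma>_bounds s] average_load_ge[OF d that(2,1) K G \<gamma>]] .
  obtain B P where BP: "B > 0" "uncoded_placement K (real s) B P"
    and le: "\<And>d. d permutes {1..K} \<Longrightarrow> min_load K B P d \<le> corner_load K (card (orbit d ` {1..K})) s"
    using ex_optimal_placement[OF K s] by blast
  have "?avg B P \<le> corner_load K \<gamma> s"
  proof -
    have "(\<Sum>d\<in>assignments_of K G. min_load K B P d) \<le> real (card (assignments_of K G)) * corner_load K \<gamma> s"
      using assignments_of_props(3,4)[OF d] le unfolding G \<gamma> by (intro sum_bounded_above) metis
    moreover have "real (card (assignments_of K G)) > 0"
      using assignments_of_props(1,2)[OF d] unfolding G by (simp add: card_gt_0_iff)
    ultimately show ?thesis by (simp add: pos_divide_le_eq mult.commute)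
  qed
  then have eq: "corner_load K \<gamma> s = ?avg B P" using ge[OF BP] by simp
  show ?thesis unfolding opt_load_def
  proof (rule cInf_eq_minimum)
    show "corner_load K \<gamma> s \<in> {?avg B P |B P. B > 0 \<and> uncoded_placement K (real s) B P}"
      using eq BP by blast
  qed (use ge in blast)
qed

text \<open>A single cycle is a case with the largest load; it provides the converse for the worst
  case.\<close>

lemma ex_cyclic_permutation:
  fixes K :: nat
  assumes "K \<ge> 1"
  obtains d where "d permutes {1..K}" "card (orbit d ` {1..K}) = 1"
proof -
  define d :: "nat \<Rightarrow> nat" where "d x = (if x = K then 1 else if x \<in> {1..K} then Suc x else x)" for x
  have "d ` {1..K} = {1..K}"
  proof (intro equalityI subsetI)
    fix y assume y: "y \<in> {1..K}"
    show "y \<in> d ` {1..K}"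
    proof (cases "y = 1")
      case True
      then show ?thesis using assms by (intro image_eqI[of _ _ K]) (auto simp: d_def)
    next
      case False
      then show ?thesis using y by (intro image_eqI[of _ _ "y - 1"]) (auto simp: d_def)
    qed
  qed (use assms in \<open>auto simp: d_def split: if_splits\<close>)
  then have "bij_betw d {1..K} {1..K}"
    by (simp add: bij_betw_def finite_surj_inj)
  then have d: "d permutes {1..K}"
    by (rule bij_imp_permutes) (use assms in \<open>auto simp: d_def\<close>)
  have perm: "permutation d" using d permutation_permutes by blast
  have "orbit d x = orbit d 1" if "x \<in> {1..K}" for x
  proof -
    have "1 \<le> x" "x \<le> K" using that by auto
    then show ?thesis
    proof (induction x rule: dec_induct)
      case (step m)
      then have "d m = Suc m" by (auto simp: d_def)
      then show ?case using permutation_orbit_step[OF perm, of m] step by simp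
    qed simp
  qed
  then have "orbit d ` {1..K} = (\<lambda>x. orbit d 1) ` {1..K}" by (rule image_cong[OF refl])
  also have "\<dots> = {orbit d 1}" using assms by (subst image_constant_conv) simp
  finally show ?thesis using that d by simp
qed

text \<open>From below, the maximum over all assignments is at least the average over those with a
  single cycle; from above, the placement for \<open>s\<close> keeps every assignment within the
  value for one cycle.\<close>

lemma opt_worst_case_load_integer:
  assumes K: "K \<ge> 1" and s: "1 \<le> s" "s \<le> K"
  shows "opt_worst_case_load K (real s) = real ((K - 1) choose s) / real ((K - 1) choose (s - 1))"
proof -
  let ?max = "\<lambda>B P. Max ((\<lambda>d. min_load K B P d) ` {d. d permutes {1..K}})"
  have fin: "finite {d. d permutes {1..K}}" by (simp add: finite_permutations)
  have ne: "{d. d permutes {1..K}} \<noteq> {}" using permutes_id by blast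
  have one: "corner_load K 1 s = real ((K - 1) choose s) / real ((K - 1) choose (s - 1))"
    using s by (simp add: corner_load_def)
  obtain d where d: "d permutes {1..K}" "1 = card (orbit d ` {1..K})"
    using ex_cyclic_permutation[OF K] by metis
  let ?G = "transition_graph K d"
  have ge: "corner_load K 1 s \<le> ?max B P" if BP: "B > 0" "uncoded_placement K (real s) B P" for B P
  proof -
    have "corner_load K 1 s \<le> (\<Sum>d\<in>assignments_of K ?G. min_load K B P d) / real (card (assignments_of K ?G))"
      by (rule order_trans[OF mean_corner_load_ge[OF BP(2,1) K _ _ s] average_load_ge[OF d(1) BP(2,1) K refl d(2)]])
        (use K in auto)
    also have "\<dots> \<le> ?max B P"
    proof -
      have "(\<Sum>d\<in>assignments_of K ?G. min_load K B P d) \<le> real (card (assignments_of K ?G)) * ?max B P"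
        by (intro sum_bounded_above Max_ge finite_imageI fin imageI)
          (use assignments_of_props(3)[OF d(1)] in auto)
      moreover have "real (card (assignments_of K ?G)) > 0"
        using assignments_of_props(1,2)[OF d(1)] by (simp add: card_gt_0_iff)
      ultimately show ?thesis by (simp add: pos_divide_le_eq mult.commute)
    qed
    finally show ?thesis .
  qed
  obtain B P where BP: "B > 0" "uncoded_placement K (real s) B P"
    and le: "\<And>d. d permutes {1..K} \<Longrightarrow> min_load K B P d \<le> corner_load K (card (orbit d ` {1..K})) s"
    using ex_optimal_placement[OF K s] by blast
  have "?max B P \<le> corner_load K 1 s"
    using fin ne order_trans[OF le corner_load_le] one by (intro Max.boundedI) auto
  then have eq: "corner_load K 1 s = ?max B P" using ge[OF BP] by simp
  have "opt_worst_case_load K (real s) = corner_load K 1 s"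
    unfolding opt_worst_case_load_def
  proof (rule cInf_eq_minimum)
    show "corner_load K 1 s \<in> {?max B P |B P. B > 0 \<and> uncoded_placement K (real s) B P}"
      using eq BP by blast
  qed (use ge in blast)
  then show ?thesis using one by simp
qed

section \<open>Non-integral cache sizes\<close>

lemma tendsto_nat_floor_div:
  assumes "x \<ge> 0"
  shows "(\<lambda>N. real (nat \<lfloor>real N * x\<rfloor>) / real N) \<longlonglongrightarrow> x"
proof (rule tendsto_sandwich)
  show "\<forall>\<^sub>F N in sequentially. x - 1 / real N \<le> real (nat \<lfloor>real N * x\<rfloor>) / real N"
    using eventually_gt_at_top[of 0]
  proof eventually_elim
    case (elim N)
    have "real N * x - 1 \<le> real (nat \<lfloor>real N * x\<rfloor>)" using assms by linarith
    then have "(real N * x - 1) / real N \<le> real (nat \<lfloor>real N * x\<rfloor>) / real N"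
      by (rule divide_right_mono) simp
    then show ?case using elim by (simp add: diff_divide_distrib)
  qed
  show "\<forall>\<^sub>F N in sequentially. real (nat \<lfloor>real N * x\<rfloor>) / real N \<le> x"
    using eventually_gt_at_top[of 0]
  proof eventually_elim
    case (elim N)
    have "real N * x \<ge> 0" using assms by simp
    then have "real (nat \<lfloor>real N * x\<rfloor>) \<le> real N * x" by linarith
    then show ?case using elim by (simp add: field_simps)
  qed
  have "(\<lambda>N. x - 1 / real N) \<longlonglongrightarrow> x - 0" by (intro tendsto_intros lim_1_over_n)
  then show "(\<lambda>N. x - 1 / real N) \<longlonglongrightarrow> x" by simp
qed simp

text \<open>Memory sharing: a file is split into parts that use the corner points in the proportions
  given by a convex combination. Rounding these proportions to rationals may overfill the caches, which
  a bounded number of extra uncached bits (\<open>s = 1\<close>) makes up for since \<open>S > 1\<close>.\<close>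

lemma opt_load_le_convex:
  assumes K: "K \<ge> 1" and d: "d permutes {1..K}" and G: "G = transition_graph K d"
    and \<gamma>: "\<gamma> = card (orbit d ` {1..K})" and S: "S > 1"
    and w: "\<And>s. s \<in> {1..K} \<Longrightarrow> w s \<ge> 0" "(\<Sum>s = 1..K. w s) = 1" "(\<Sum>s = 1..K. w s * real s) = S"
  shows "opt_load K S G \<le> (\<Sum>s = 1..K. w s * corner_load K \<gamma> s)"
proof -
  define c where "c s = real ((K - 1) choose (s - 1))" for s
  define l where "l s = real ((K - 1) choose s) - real ((\<gamma> - 1) choose s)" for s
  have c: "c s > 0" if "s \<in> {1..K}" for s using that by (auto simp: c_def)
  \<comment> \<open>Rounding overfills the caches by at most the sum of \<open>c s * S\<close>, and
    each extra uncached bit raises the allowance by \<open>S - 1\<close>. Positivity of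
    \<open>D\<close> keeps the file length positive.\<close>
  obtain D where D: "(\<Sum>s = 1..K. c s * S) / (S - 1) \<le> real D" "D > 0"
  proof -
    obtain D where "(\<Sum>s = 1..K. c s * S) / (S - 1) \<le> real D" using real_arch_simple by blast
    then show ?thesis using that[of "Suc D"] by simp
  qed
  \<comment> \<open>A file has \<open>c s\<close> sets of size \<open>s\<close>, so dividing by
    \<open>c s\<close> gives these sets a fraction of about \<open>w s\<close> of a file whose
    length is about \<open>N\<close>.\<close>
  define n where "n N s = nat \<lfloor>real N * (w s / c s)\<rfloor> + (if s = 1 then D else 0)" for N s
  define L where "L N = (\<Sum>s = 1..K. real (n N s) * l s) / (\<Sum>s = 1..K. c s * real (n N s))" for N
  have le: "opt_load K S G \<le> L N" for N
  proof -
    interpret subset_placement K "n N" .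
    have realB: "real B = (\<Sum>s = 1..K. c s * real (n N s))" by (simp add: B_def c_def)
    have "real B > 0"
      unfolding realB
    proof (rule sum_pos2[of _ 1])
      show "0 < c 1 * real (n N 1)" using c[of 1] K D by (simp add: n_def)
      show "0 \<le> c s * real (n N s)" if "s \<in> {1..K}" for s using c[OF that] by simp
    qed (use K in auto)
    then have B: "B > 0" by simp
    have "real (\<Sum>s = 1..K. ((K - 1) choose (s - 1)) * ((s - 1) * n N s))
        = (\<Sum>s = 1..K. c s * real (n N s) * (real s - 1))"
      unfolding of_nat_sum by (intro sum.cong refl) (auto simp: c_def of_nat_diff)
    also have "\<dots> = (S - 1) * real B + (\<Sum>s = 1..K. c s * real (n N s) * (real s - S))"
      unfolding realB sum_distrib_left sum.distrib[symmetric]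
      by (intro sum.cong refl) (simp add: algebra_simps)
    also have "(\<Sum>s = 1..K. c s * real (n N s) * (real s - S))
        \<le> (\<Sum>s = 1..K. real N * (w s * real s) - real N * S * w s + c s * S + (if s = 1 then real D * (1 - S) else 0))"
    proof (rule sum_mono)
      fix s assume s: "s \<in> {1..K}"
      define \<delta> where "\<delta> = real N * (w s / c s) - real (nat \<lfloor>real N * (w s / c s)\<rfloor>)"
      have "real N * (w s / c s) \<ge> 0" using w(1)[OF s] c[OF s] by simp
      then have \<delta>: "0 \<le> \<delta>" "\<delta> \<le> 1" unfolding \<delta>_def by linarith+
      have ns: "real (n N s) = real N * (w s / c s) - \<delta> + (if s = 1 then real D else 0)"
        by (simp add: n_def \<delta>_def)
      have *: "c s * real (n N s) = real N * w s - c s * \<delta> + (if s = 1 then real D else 0)"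
        using c[OF s] unfolding ns by (simp add: field_simps c_def)
      have "c s * real (n N s) * (real s - S)
          = real N * (w s * real s) - real N * S * w s + c s * \<delta> * (S - real s) + (if s = 1 then real D * (1 - S) else 0)"
        unfolding * by (simp add: algebra_simps)
      moreover have "\<delta> * (S - real s) \<le> 1 * S"
      proof -
        have "\<delta> * (S - real s) \<le> \<delta> * S" using \<delta> by (intro mult_left_mono) auto
        also have "\<dots> \<le> 1 * S" using \<delta> S by (intro mult_right_mono) auto
        finally show ?thesis .
      qed
      then have "c s * \<delta> * (S - real s) \<le> c s * S"
        using mult_left_mono[of "\<delta> * (S - real s)" S "c s"] c[OF s] by (simp add: mult.assoc)
      ultimately show "c s * real (n N s) * (real s - S)
          \<le> real N * (w s * real s) - real N * S * w s + c s * S + (if s = 1 then real D * (1 - S) else 0)"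
        by simp
    qed
    also have "\<dots> = real N * S - real N * S * 1 + (\<Sum>s = 1..K. c s * S) + real D * (1 - S)"
      using K by (simp add: sum.distrib sum_subtractf sum_distrib_left[symmetric] w[unfolded One_nat_def])
    also have "\<dots> \<le> 0" using D(1) S by (simp add: pos_divide_le_eq algebra_simps)
    finally have P: "uncoded_placement K S B P" by (intro uncoded) simp
    have upper: "min_load K B P d' \<le> L N" if "d' \<in> assignments_of K G" for d'
    proof -
      have d': "d' permutes {1..K}" "card (orbit d' ` {1..K}) = \<gamma>"
        using assignments_of_props(3,4)[OF d] that unfolding G \<gamma> by blast+
      show ?thesis using min_load_upper[OF d'(1) K] unfolding d'(2) L_def l_def realB .
    qed
    have "(\<Sum>d\<in>assignments_of K G. min_load K B P d) \<le> real (card (assignments_of K G)) * L N"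
      using upper by (intro sum_bounded_above)
    moreover have "real (card (assignments_of K G)) > 0"
      using assignments_of_props(1,2)[OF d] unfolding G by (simp add: card_gt_0_iff)
    ultimately have "(\<Sum>d\<in>assignments_of K G. min_load K B P d) / real (card (assignments_of K G)) \<le> L N"
      by (simp add: pos_divide_le_eq mult.commute)
    moreover have "opt_load K S G \<le> (\<Sum>d\<in>assignments_of K G. min_load K B P d) / real (card (assignments_of K G))"
      unfolding opt_load_def
    proof (rule cInf_lower)
      show "bdd_below {(\<Sum>d\<in>assignments_of K G. min_load K B P d) / real (card (assignments_of K G)) |B P.
            B > 0 \<and> uncoded_placement K S B P}"
        by (rule bdd_belowI[of _ 0]) (auto intro!: divide_nonneg_nonneg sum_nonneg min_load_nonneg)
    qed (use B P in blast)
    ultimately show ?thesis by simp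
  qed
  have n_lim: "(\<lambda>N. real (n N s) / real N) \<longlonglongrightarrow> w s / c s" if s: "s \<in> {1..K}" for s
  proof -
    have "(\<lambda>N. real (nat \<lfloor>real N * (w s / c s)\<rfloor>) / real N + (if s = 1 then real D else 0) * (1 / real N))
        \<longlonglongrightarrow> w s / c s + (if s = 1 then real D else 0) * 0"
      using w(1)[OF s] c[OF s] by (intro tendsto_intros tendsto_nat_floor_div lim_1_over_n) simp
    then show ?thesis by (cases "s = 1") (simp_all add: n_def add_divide_distrib)
  qed
  have num_lim: "(\<lambda>N. \<Sum>s = 1..K. real (n N s) / real N * l s) \<longlonglongrightarrow> (\<Sum>s = 1..K. w s / c s * l s)"
    by (rule tendsto_sum, rule tendsto_mult, rule n_lim, assumption, rule tendsto_const)
  have den_lim: "(\<lambda>N. \<Sum>s = 1..K. c s * (real (n N s) / real N)) \<longlonglongrightarrow> (\<Sum>s = 1..K. c s * (w s / c s))"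
    by (rule tendsto_sum, rule tendsto_mult, rule tendsto_const, rule n_lim)
  have den: "(\<Sum>s = 1..K. c s * (w s / c s)) = 1"
    unfolding w(2)[symmetric] by (intro sum.cong refl) (use c in force)
  have num: "(\<Sum>s = 1..K. w s / c s * l s) = (\<Sum>s = 1..K. w s * corner_load K \<gamma> s)"
    by (simp add: corner_load_def c_def l_def)
  \<comment> \<open>Numerator and denominator are divided by \<open>N\<close>, which makes the
    bounded correction \<open>D\<close> vanish in the limit.\<close>
  have ev: "\<forall>\<^sub>F N in sequentially.
      (\<Sum>s = 1..K. real (n N s) / real N * l s) / (\<Sum>s = 1..K. c s * (real (n N s) / real N)) = L N"
    using eventually_gt_at_top[of 0]
  proof eventually_elim
    case (elim N)
    then show ?case by (simp add: L_def sum_divide_distrib[symmetric])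
  qed
  have "(\<Sum>s = 1..K. c s * (w s / c s)) \<noteq> 0" unfolding den by (rule one_neq_zero)
  from Lim_transform_eventually[OF tendsto_divide[OF num_lim den_lim this] ev]
  have "L \<longlonglongrightarrow> (\<Sum>s = 1..K. w s * corner_load K \<gamma> s)"
    by (simp only: den num div_by_1)
  then show ?thesis by (rule LIMSEQ_le_const) (use le in blast)
qed

text \<open>Corner points with different \<open>s\<close> are distinct, so weights on the points can
  be indexed by \<open>{1..K}\<close>.\<close>

lemma convex_hull_graph_weights:
  fixes f :: "nat \<Rightarrow> real"
  assumes "(S, y) \<in> convex hull ((\<lambda>s. (real s, f s)) ` {1..K})"
  obtains w where "\<And>s. s \<in> {1..K} \<Longrightarrow> w s \<ge> 0" "(\<Sum>s = 1..K. w s) = 1"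
    "(\<Sum>s = 1..K. w s * real s) = S" "(\<Sum>s = 1..K. w s * f s) = y"
proof -
  let ?p = "\<lambda>s. (real s, f s)"
  have inj: "inj_on ?p {1..K}" by (auto simp: inj_on_def)
  obtain u where u: "\<forall>x\<in>?p ` {1..K}. 0 \<le> u x" "sum u (?p ` {1..K}) = 1"
      "(\<Sum>x\<in>?p ` {1..K}. u x *\<^sub>R x) = (S, y)"
    using assms by (subst (asm) convex_hull_finite) auto
  have "(\<Sum>s = 1..K. u (?p s) *\<^sub>R ?p s) = (S, y)"
    using u(3) unfolding sum.reindex[OF inj] o_def .
  from arg_cong[OF this, of fst] arg_cong[OF this, of snd]
  have "(\<Sum>s = 1..K. u (?p s) * real s) = S" "(\<Sum>s = 1..K. u (?p s) * f s) = y"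
    by (simp_all add: fst_sum snd_sum)
  moreover have "(\<Sum>s = 1..K. u (?p s)) = 1" using u(2) unfolding sum.reindex[OF inj] o_def .
  ultimately show ?thesis using that[of "\<lambda>s. u (?p s)"] u(1) by auto
qed

text \<open>The centroid of the corner points belonging to all bits lies in the convex hull at an
  abscissa of at most \<open>S\<close>. Moving from it towards the corner point
  \<open>(K, 0)\<close> up to abscissa \<open>S\<close> does not increase the load.\<close>

lemma lower_convex_envelope_le_mean:
  assumes P: "uncoded_placement K S B P" and B: "B > 0" and K: "K \<ge> 1"
    and \<gamma>: "1 \<le> \<gamma>" "\<gamma> \<le> K" and S: "1 \<le> S" "S < real K"
  shows "lower_convex_envelope ((\<lambda>s. (real s, corner_load K \<gamma> s)) ` {1..K}) S
    \<le> (\<Sum>i\<in>{1..K}. \<Sum>b<B. corner_load K \<gamma> (Suc (caching_multiplicity K P i b))) / (real K * real B)"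
proof -
  let ?t = "caching_multiplicity K P"
  let ?p = "\<lambda>s. (real s, corner_load K \<gamma> s)"
  let ?H = "convex hull (?p ` {1..K})"
  let ?I = "{1..K} \<times> {..<B}"
  have KB: "real K * real B > 0" using K B by simp
  have mem: "Suc (?t i b) \<in> {1..K}" if "i \<in> {1..K}" for i b
    using caching_multiplicity_less[OF that] by auto
  define y where "y = (\<Sum>i\<in>{1..K}. \<Sum>b<B. corner_load K \<gamma> (Suc (?t i b))) / (real K * real B)"
  define x where "x = (\<Sum>i\<in>{1..K}. \<Sum>b<B. real (Suc (?t i b))) / (real K * real B)"
  have nonneg: "?H \<subseteq> {p. 0 \<le> snd p}"
  proof (rule hull_minimal)
    show "?p ` {1..K} \<subseteq> {p. 0 \<le> snd p}" using corner_load_nonneg[OF \<gamma>] by auto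
  qed (auto simp: convex_def)
  have "(\<Sum>ib\<in>?I. (1 / (real K * real B)) *\<^sub>R ?p (Suc (?t (fst ib) (snd ib)))) \<in> ?H"
  proof (rule convex_sum)
    show "(\<Sum>ib\<in>?I. 1 / (real K * real B)) = 1" using K B by simp
    show "?p (Suc (?t (fst ib) (snd ib))) \<in> ?H" if "ib \<in> ?I" for ib
      by (rule hull_inc, rule imageI[of _ _ ?p], rule mem) (use that in auto)
  qed auto
  moreover have "(\<Sum>ib\<in>?I. (1 / (real K * real B)) *\<^sub>R ?p (Suc (?t (fst ib) (snd ib)))) = (x, y)"
    by (simp add: prod_eq_iff fst_sum snd_sum x_def y_def sum.cartesian_product sum_divide_distrib
        case_prod_beta)
  ultimately have xy: "(x, y) \<in> ?H" by simp
  then have y: "y \<ge> 0" using nonneg by auto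
  have "(\<Sum>i\<in>{1..K}. \<Sum>b<B. real (Suc (?t i b)))
      = real K * real B + (\<Sum>i\<in>{1..K}. \<Sum>b<B. real (?t i b))"
    by (simp add: sum.distrib)
  also have "\<dots> \<le> S * (real K * real B)"
    using sum_caching_multiplicity_le[OF P] by (simp add: algebra_simps)
  finally have xS: "x \<le> S" unfolding x_def using KB by (simp add: pos_divide_le_eq)
  \<comment> \<open>The weight at which the segment from \<open>(x, y)\<close> to
    \<open>(K, 0)\<close> has abscissa \<open>S\<close>.\<close>
  define \<theta> where "\<theta> = (real K - S) / (real K - x)"
  have \<theta>: "0 \<le> \<theta>" "\<theta> \<le> 1" using xS S by (auto simp: \<theta>_def)
  have "?p K \<in> ?H" by (rule hull_inc) (use K in auto)
  then have K0: "(real K, 0) \<in> ?H" using corner_load_full[OF \<gamma>] by simp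
  have "\<theta> *\<^sub>R (x, y) + (1 - \<theta>) *\<^sub>R (real K, 0) \<in> ?H"
    by (rule convexD[OF convex_convex_hull xy K0]) (use \<theta> in auto)
  moreover have "\<theta> * x + (1 - \<theta>) * real K = S"
  proof -
    have "\<theta> * (real K - x) = real K - S" using xS S by (simp add: \<theta>_def)
    then show ?thesis by (simp add: algebra_simps)
  qed
  ultimately have "(S, \<theta> * y) \<in> ?H" by simp
  then have "lower_convex_envelope (?p ` {1..K}) S \<le> \<theta> * y"
    unfolding lower_convex_envelope_def
    by (intro cInf_lower bdd_belowI[of _ 0]) (use nonneg in auto)
  also have "\<dots> \<le> y" using mult_right_mono[OF \<theta>(2) y] by simp
  finally show ?thesis by (simp add: y_def)
qed

lemma opt_load_noninteger:
  assumes K: "K \<ge> 1" and d: "d permutes {1..K}" and G: "G = transition_graph K d"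
    and \<gamma>: "\<gamma> = card (orbit d ` {1..K})" and S: "1 < S" "S < real K"
  shows "opt_load K S G = lower_convex_envelope ((\<lambda>s. (real s, corner_load K \<gamma> s)) ` {1..K}) S"
proof (rule antisym)
  let ?p = "\<lambda>s. (real s, corner_load K \<gamma> s)"
  let ?H = "convex hull (?p ` {1..K})"
  have \<gamma>_bounds: "1 \<le> \<gamma>" "\<gamma> \<le> K" using card_orbits_bounds[OF d K] \<gamma> by auto
  have "(S, y) \<in> ?H \<Longrightarrow> opt_load K S G \<le> y" for y
    by (erule convex_hull_graph_weights) (use opt_load_le_convex[OF K d G \<gamma> S(1)] in blast)
  moreover have "\<exists>y. (S, y) \<in> ?H"
  proof -
    define \<theta> where "\<theta> = (real K - S) / (real K - 1)"
    have \<theta>: "0 \<le> \<theta>" "\<theta> \<le> 1" using S by (auto simp: \<theta>_def)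
    have "\<theta> *\<^sub>R ?p 1 + (1 - \<theta>) *\<^sub>R ?p K \<in> ?H"
      by (rule convexD[OF convex_convex_hull]) (use \<theta> K in \<open>auto intro!: hull_inc\<close>)
    moreover have "\<theta> * 1 + (1 - \<theta>) * real K = S"
    proof -
      have "\<theta> * (real K - 1) = real K - S" using S by (simp add: \<theta>_def)
      then show ?thesis by (simp add: algebra_simps)
    qed
    ultimately show ?thesis by auto
  qed
  ultimately show "opt_load K S G \<le> lower_convex_envelope (?p ` {1..K}) S"
    unfolding lower_convex_envelope_def by (intro cInf_greatest) auto
  \<comment> \<open>A placement for cache size one is also one for \<open>S\<close>, so the set of
    loads is nonempty.\<close>
  obtain B P where BP: "B > 0" "uncoded_placement K (real 1) B P"
    using ex_optimal_placement[OF K, of 1] K by blast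
  have "(1 - 1) * real B \<le> (S - 1) * real B" using S by (intro mult_right_mono) auto
  then have "uncoded_placement K S B P" using BP unfolding uncoded_placement_def by fastforce
  then have "{(\<Sum>d\<in>assignments_of K G. min_load K B P d) / real (card (assignments_of K G)) |B P.
            B > 0 \<and> uncoded_placement K S B P} \<noteq> {}" using BP by blast
  then show "lower_convex_envelope (?p ` {1..K}) S \<le> opt_load K S G"
    unfolding opt_load_def
  proof (rule cInf_greatest)
    fix a assume "a \<in> {(\<Sum>d\<in>assignments_of K G. min_load K B P d) / real (card (assignments_of K G)) |B P.
            B > 0 \<and> uncoded_placement K S B P}"
    then obtain B P where BP: "B > 0" "uncoded_placement K S B P"
      and a: "a = (\<Sum>d\<in>assignments_of K G. min_load K B P d) / real (card (assignments_of K G))" by blast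
    show "lower_convex_envelope (?p ` {1..K}) S \<le> a" unfolding a
      by (rule order_trans[OF lower_convex_envelope_le_mean[OF BP(2,1) K \<gamma>_bounds] average_load_ge[OF d BP(2,1) K G \<gamma>]])
        (use S in auto)
  qed
qed

theorem corollary1:
  fixes K \<gamma> :: nat and G :: "(nat, nat) pre_digraph"
  assumes "K \<ge> 1"
    and "is_file_transition_graph K G"
    and "num_cycles G = \<gamma>"
  shows "(\<forall>s\<in>{1..K}. opt_load K (real s) G = corner_load K \<gamma> s)
    \<and> (\<forall>S::real. 1 \<le> S \<and> S \<le> real K \<and> S \<notin> \<int> \<longrightarrow>
         opt_load K S G
           = lower_convex_envelope ((\<lambda>s. (real s, corner_load K \<gamma> s)) ` {1..K}) S)
    \<and> (\<forall>s\<in>{1..K}. \<gamma> - 1 < s \<longrightarrow>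
         corner_load K \<gamma> s = real ((K - 1) choose s) / real ((K - 1) choose (s - 1))
         \<and> corner_load K \<gamma> s = Max ((\<lambda>\<gamma>'. corner_load K \<gamma>' s) ` {1..K}))
    \<and> (\<forall>s\<in>{1..K}. opt_worst_case_load K (real s)
           = real ((K - 1) choose s) / real ((K - 1) choose (s - 1)))"
proof -
  obtain d where d: "d permutes {1..K}" and G: "G = transition_graph K d"
    using assms(2) by (auto simp: is_file_transition_graph_def)
  have \<gamma>: "\<gamma> = card (orbit d ` {1..K})"
    using assms(3) num_cycles_transition_graph[OF d] G by simp
  have "opt_load K S G = lower_convex_envelope ((\<lambda>s. (real s, corner_load K \<gamma> s)) ` {1..K}) S"
    if S: "1 \<le> S" "S \<le> real K" "S \<notin> \<int>" for S
  proof -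
    have "S \<noteq> 1" "S \<noteq> real K" using S(3) by auto
    then show ?thesis using S by (intro opt_load_noninteger[OF assms(1) d G \<gamma>]) auto
  qed
  then show ?thesis
    using opt_load_integer[OF assms(1) d G \<gamma>] corner_load_eq_max[OF assms(1)]
      opt_worst_case_load_integer[OF assms(1)]
    by auto
qed

end
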